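(* Let $G$ be an $m$-uniform hypergraph on $n$ nodes with properly connected components. Let $e$ denote the number of edges, $p$ the number of pivot equivalence classes and $c$ the number of connected components of $G$. Then the height of the toric edge ideal $I_G$ of $G$ is $$\mathrm{ht}\, I_G=e-n+p-c.$$
   Context: A hypergraph $G$ has a finite node set $V(G)=\{x_1,\dots,x_n\}$ and an edge set $E(G)$ consisting of finitely many subsets of $V(G)$; it is $m$-uniform if every edge has size $m$. Standing assumptions: $G$ has no isolated nodes (every node lies in some edge), and each connected component of $G$ has at least as many edges as nodes. $G$ is connected if for any two nodes there is a sequence of edges such that the two nodes belong to the first and the last edge of the sequence respectively, and consecutive edges have a common node. An $m$-uniform hypergraph is properly connected if for any two edges $u,v$ there is a sequence of edges starting with $u$ and ending with $v$ such that the intersection of consecutive edges has size $m-1$. Pivot equivalence is defined on the set of all nodes of $G$: $x_i\approx x_j$ if there is a subset $A\subset V(G)\setminus\{x_i,x_j\}$ such that $\{x_i\}\cup A$ and $\{x_j\}\cup A$ are edges of $G$; and $x_i\sim x_j$ if there is a sequence of nodes $x_i=x_{i_1}\approx x_{i_2}\approx\cdots\approx x_{i_r}=x_j$. The equivalence classes of $\sim$ are the pivot equivalence classes of $G$. Toric edge ideal: fix a field $\Bbbk$, view the nodes as indeterminates, and let $\Bbbk[G]$ be the $\Bbbk$-algebra generated by the monomials $x_{i_1}\cdots x_{i_m}$ with $\{x_{i_1},\dots,x_{i_m}\}\in E(G)$. Let $S=\Bbbk[T_\alpha:\alpha\in E(G)]$ be the polynomial ring with one variable per edge and $\phi:S\to\Bbbk[G]$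 the $\Bbbk$-algebra epimorphism sending $T_\alpha$ to the product of the nodes in $\alpha$. Then $I_G=\ker\phi$.
   Formalization: The case m = 1 is excluded: for n ≥ 2 singleton edges, taking A empty makes all nodes pivot equivalent, so e−n+p−c = 1−n < 0 while I_G = 0 has height 0; only the trivial valid case of one node with its singleton edge is lost. *)

theory Defs
  imports
    "HOL-Library.Poly_Mapping"
    "HOL-Library.Extended_Real"
    "HOL-Algebra.Generated_Rings"
    "HOL-Algebra.RingHom"
begin

section \<open>Hypergraphs\<close>

text \<open>A hypergraph is given by its node set \<open>V\<close> and its edge set \<open>E\<close>.\<close>

definition hypergraph :: "'a set \<Rightarrow> 'a set set \<Rightarrow> bool" where
  "hypergraph V E \<longleftrightarrow> finite V \<and> E \<subseteq> Pow V"

definition uniform :: "nat \<Rightarrow> 'a set set \<Rightarrow> bool" where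
  "uniform m E \<longleftrightarrow> (\<forall>\<alpha>\<in>E. card \<alpha> = m)"

definition no_isolated_nodes :: "'a set \<Rightarrow> 'a set set \<Rightarrow> bool" where
  "no_isolated_nodes V E \<longleftrightarrow> (\<forall>x\<in>V. \<exists>\<alpha>\<in>E. x \<in> \<alpha>)"

definition connection :: "'a set \<Rightarrow> 'a set set \<Rightarrow> ('a \<times> 'a) set" where
  "connection V E = {(x, y). x \<in> V \<and> y \<in> V \<and> (x = y \<or>
     (\<exists>\<alpha>s. \<alpha>s \<noteq> [] \<and> set \<alpha>s \<subseteq> E \<and> x \<in> hd \<alpha>s \<and> y \<in> last \<alpha>s \<and>
           successively (\<lambda>\<alpha> \<beta>. \<alpha> \<inter> \<beta> \<noteq> {}) \<alpha>s))}"

text \<open>A connected component is the hypergraph with node set \<open>C \<in> components V E\<close>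
  and edge set \<open>edges_on E C\<close>.\<close>

definition components :: "'a set \<Rightarrow> 'a set set \<Rightarrow> 'a set set" where
  "components V E = V // connection V E"

definition edges_on :: "'a set set \<Rightarrow> 'a set \<Rightarrow> 'a set set" where
  "edges_on E C = {\<alpha>\<in>E. \<alpha> \<subseteq> C}"

definition properly_connected :: "nat \<Rightarrow> 'a set set \<Rightarrow> bool" where
  "properly_connected m E \<longleftrightarrow> (\<forall>u\<in>E. \<forall>v\<in>E. \<exists>\<alpha>s. \<alpha>s \<noteq> [] \<and> set \<alpha>s \<subseteq> E \<and>
     hd \<alpha>s = u \<and> last \<alpha>s = v \<and> successively (\<lambda>\<alpha> \<beta>. card (\<alpha> \<inter> \<beta>) = m - 1) \<alpha>s)"

text \<open>\<open>A\<close> may be empty, so in a 1-uniform hypergraph all nodes lying in an edge are pivot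
  equivalent, even nodes of different connected components. Results counting pivot classes
  componentwise therefore need to exclude \<open>m = 1\<close>.\<close>

definition pivot_adjacent :: "'a set \<Rightarrow> 'a set set \<Rightarrow> 'a \<Rightarrow> 'a \<Rightarrow> bool" where
  "pivot_adjacent V E x y \<longleftrightarrow> x \<in> V \<and> y \<in> V \<and>
     (\<exists>A. A \<subseteq> V - {x, y} \<and> {x} \<union> A \<in> E \<and> {y} \<union> A \<in> E)"

definition pivot_equivalence :: "'a set \<Rightarrow> 'a set set \<Rightarrow> ('a \<times> 'a) set" where
  "pivot_equivalence V E = {(x, y). x \<in> V \<and> y \<in> V \<and> (pivot_adjacent V E)\<^sup>*\<^sup>* x y}"

definition pivot_classes :: "'a set \<Rightarrow> 'a set set \<Rightarrow> 'a set set" where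
  "pivot_classes V E = V // pivot_equivalence V E"

section \<open>Polynomial rings\<close>

text \<open>Polynomials with indeterminates of type \<open>'v\<close>: a monomial is a finitely supported
  exponent function, a polynomial a finitely supported family of coefficients.\<close>

type_synonym ('v, 'k) mpoly = "('v \<Rightarrow>\<^sub>0 nat) \<Rightarrow>\<^sub>0 'k"

definition mconst :: "'k \<Rightarrow> ('v, 'k::field) mpoly" where
  "mconst c = Poly_Mapping.single 0 c"

definition mvar :: "'v \<Rightarrow> ('v, 'k::field) mpoly" where
  "mvar x = Poly_Mapping.single (Poly_Mapping.single x 1) 1"

definition mpoly_ring :: "'v set \<Rightarrow> ('v, 'k::field) mpoly ring" where
  "mpoly_ring X =
     \<lparr>carrier = {p. \<forall>t\<in>Poly_Mapping.keys p. Poly_Mapping.keys t \<subseteq> X},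
      monoid.mult = (*), one = 1, zero = 0, add = (+)\<rparr>"

text \<open>Substitution of \<open>f x\<close> for each indeterminate \<open>x\<close>.\<close>

definition mpoly_subst :: "('v \<Rightarrow> ('w, 'k) mpoly) \<Rightarrow> ('v, 'k::field) mpoly \<Rightarrow> ('w, 'k) mpoly" where
  "mpoly_subst f p =
     (\<Sum>t\<in>Poly_Mapping.keys p. mconst (Poly_Mapping.lookup p t) *
       (\<Prod>x\<in>Poly_Mapping.keys t. f x ^ Poly_Mapping.lookup t x))"

section \<open>The toric edge ideal\<close>

definition edge_monomial :: "'a set \<Rightarrow> ('a, 'k::field) mpoly" where
  "edge_monomial \<alpha> = (\<Prod>x\<in>\<alpha>. mvar x)"

text \<open>The subalgebra generated by the edge monomials is the subring generated by them together
  with the constants.\<close>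

definition edge_ring :: "'a set \<Rightarrow> 'a set set \<Rightarrow> ('a, 'k::field) mpoly ring" where
  "edge_ring V E =
     (mpoly_ring V)\<lparr>carrier := generate_ring (mpoly_ring V) (range mconst \<union> edge_monomial ` E)\<rparr>"

definition toric_map :: "('a set, 'k::field) mpoly \<Rightarrow> ('a, 'k) mpoly" where
  "toric_map = mpoly_subst edge_monomial"

definition toric_ideal :: "'a set \<Rightarrow> 'a set set \<Rightarrow> ('a set, 'k::field) mpoly set" where
  "toric_ideal V E = a_kernel (mpoly_ring E) (edge_ring V E) toric_map"

section \<open>Height\<close>

text \<open>The height of a prime is the supremum of the lengths of chains of primes descending from it;
  the height of an ideal is the infimum over all primes containing it (\<open>\<infinity>\<close> for the unit ideal).\<close>

definition prime_height :: "('r, 'x) ring_scheme \<Rightarrow> 'r set \<Rightarrow> enat" where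
  "prime_height R P = Sup {enat n | n. \<exists>Q :: nat \<Rightarrow> 'r set.
     (\<forall>i\<le>n. primeideal (Q i) R) \<and> (\<forall>i<n. Q i \<subset> Q (Suc i)) \<and> Q n = P}"

definition ideal_height :: "('r, 'x) ring_scheme \<Rightarrow> 'r set \<Rightarrow> enat" where
  "ideal_height R I = Inf (prime_height R ` {P. primeideal P R \<and> I \<subseteq> P})"

section \<open>Well-definedness\<close>

lemma mpoly_ring_simps:
  "carrier (mpoly_ring X) = {p. \<forall>t\<in>Poly_Mapping.keys p. Poly_Mapping.keys t \<subseteq> X}"
  "x \<otimes>\<^bsub>mpoly_ring X\<^esub> y = x * y" "x \<oplus>\<^bsub>mpoly_ring X\<^esub> y = x + y"
  "\<one>\<^bsub>mpoly_ring X\<^esub> = 1" "\<zero>\<^bsub>mpoly_ring X\<^esub> = 0"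
  by (simp_all add: mpoly_ring_def)

lemma mpoly_carrier_add:
  "p \<in> carrier (mpoly_ring X) \<Longrightarrow> q \<in> carrier (mpoly_ring X) \<Longrightarrow> p + q \<in> carrier (mpoly_ring X)"
  using Poly_Mapping.keys_add[of p q] by (fastforce simp: mpoly_ring_simps)

lemma mpoly_carrier_mult:
  assumes "p \<in> carrier (mpoly_ring X)" "q \<in> carrier (mpoly_ring X)"
  shows "p * q \<in> carrier (mpoly_ring X)"
  unfolding mpoly_ring_simps
proof safe
  fix t x assume "t \<in> Poly_Mapping.keys (p * q)" and x: "x \<in> Poly_Mapping.keys t"
  then obtain a b where "t = a + b" "a \<in> Poly_Mapping.keys p" "b \<in> Poly_Mapping.keys q"
    using keys_mult[of p q] by blast
  then show "x \<in> X"
    using assms x Poly_Mapping.keys_add[of a b] by (fastforce simp: mpoly_ring_simps)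
qed

lemma mpoly_ring_cring: "cring (mpoly_ring X)"
proof (rule cringI)
  show "abelian_group (mpoly_ring X)"
  proof (rule abelian_groupI)
    fix p assume "p \<in> carrier (mpoly_ring X)"
    then show "\<exists>q\<in>carrier (mpoly_ring X). q \<oplus>\<^bsub>mpoly_ring X\<^esub> p = \<zero>\<^bsub>mpoly_ring X\<^esub>"
      by (intro bexI[of _ "- p"]) (auto simp: mpoly_ring_simps in_keys_iff)
  qed (auto simp: mpoly_carrier_add add_ac mpoly_ring_simps(2-5), simp_all add: mpoly_ring_simps)
  show "comm_monoid (mpoly_ring X)"
    by (rule comm_monoidI)
       (auto simp: mpoly_carrier_mult mult_ac mpoly_ring_simps(2-5), simp_all add: mpoly_ring_simps)
qed (simp_all add: mpoly_ring_simps algebra_simps)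

lemma mpoly_subst_superset:
  assumes "finite A" "Poly_Mapping.keys p \<subseteq> A"
  shows "mpoly_subst f p =
     (\<Sum>t\<in>A. mconst (Poly_Mapping.lookup p t) *
       (\<Prod>x\<in>Poly_Mapping.keys t. f x ^ Poly_Mapping.lookup t x))"
  unfolding mpoly_subst_def
  by (rule sum.mono_neutral_left) (use assms in \<open>auto simp: mconst_def in_keys_iff\<close>)

lemma mpoly_subst_add: "mpoly_subst f (p + q) = mpoly_subst f p + mpoly_subst f q"
proof -
  let ?A = "Poly_Mapping.keys p \<union> Poly_Mapping.keys q"
  have "Poly_Mapping.keys (p + q) \<subseteq> ?A" by (rule Poly_Mapping.keys_add)
  then show ?thesis
    by (simp add: mpoly_subst_superset[of ?A] lookup_add mconst_def single_add
        distrib_right sum.distrib)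
qed

lemma monomial_subst_add:
  fixes f :: "'v \<Rightarrow> ('w, 'k::field) mpoly"
  shows "(\<Prod>x\<in>Poly_Mapping.keys (s + t). f x ^ Poly_Mapping.lookup (s + t) x) =
    (\<Prod>x\<in>Poly_Mapping.keys s. f x ^ Poly_Mapping.lookup s x) * (\<Prod>x\<in>Poly_Mapping.keys t. f x ^ Poly_Mapping.lookup t x)"
proof -
  have *: "(\<Prod>x\<in>Poly_Mapping.keys u. f x ^ Poly_Mapping.lookup u x) =
      (\<Prod>x\<in>Poly_Mapping.keys (s + t). f x ^ Poly_Mapping.lookup u x)"
    if "Poly_Mapping.keys u \<subseteq> Poly_Mapping.keys (s + t)" for u :: "'v \<Rightarrow>\<^sub>0 nat"
    by (rule prod.mono_neutral_left) (use that in \<open>auto simp: in_keys_iff\<close>)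
  have "Poly_Mapping.keys s \<subseteq> Poly_Mapping.keys (s + t)"
    "Poly_Mapping.keys t \<subseteq> Poly_Mapping.keys (s + t)"
    by (auto simp: in_keys_iff lookup_add)
  then show ?thesis
    by (simp add: *[of s] *[of t]) (simp add: lookup_add power_add prod.distrib)
qed

lemma mpoly_subst_single:
  "mpoly_subst f (Poly_Mapping.single t c) =
     mconst c * (\<Prod>x\<in>Poly_Mapping.keys t. f x ^ Poly_Mapping.lookup t x)"
  by (cases "c = 0") (auto simp: mpoly_subst_def mconst_def)

lemma mpoly_expand:
  "p = (\<Sum>t\<in>Poly_Mapping.keys p. Poly_Mapping.single t (Poly_Mapping.lookup p t))"
  by (rule poly_mapping_eqI)
     (auto simp: lookup_sum lookup_single when_def in_keys_iff)

lemma mpoly_subst_sum: "mpoly_subst f (sum g A) = (\<Sum>i\<in>A. mpoly_subst f (g i))"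
proof (induction A rule: infinite_finite_induct)
qed (auto simp: mpoly_subst_add, simp_all add: mpoly_subst_def)

lemma mpoly_subst_mult: "mpoly_subst f (p * q) = mpoly_subst f p * mpoly_subst f q"
proof -
  have "p * q = (\<Sum>s\<in>Poly_Mapping.keys p. \<Sum>t\<in>Poly_Mapping.keys q.
      Poly_Mapping.single (s + t) (Poly_Mapping.lookup p s * Poly_Mapping.lookup q t))"
    by (subst mpoly_expand[of p], subst mpoly_expand[of q])
       (simp add: sum_product mult_single)
  then have "mpoly_subst f (p * q) = (\<Sum>s\<in>Poly_Mapping.keys p. \<Sum>t\<in>Poly_Mapping.keys q.
      mpoly_subst f (Poly_Mapping.single s (Poly_Mapping.lookup p s)) *
      mpoly_subst f (Poly_Mapping.single t (Poly_Mapping.lookup q t)))"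
    by (simp add: mpoly_subst_sum mpoly_subst_single monomial_subst_add mconst_def
        mult_ac flip: mult_single[of 0 _ 0, simplified])
  then show ?thesis
    by (simp add: mpoly_subst_def[of f p] mpoly_subst_def[of f q] mpoly_subst_single sum_product)
qed

lemma mpoly_subst_mvar: "mpoly_subst f (mvar x) = f x"
  by (simp add: mvar_def mpoly_subst_single mconst_def)

lemma mpoly_subst_mconst: "mpoly_subst f (mconst c) = mconst c"
  using mpoly_subst_single[of f 0 c] by (simp add: mconst_def)

lemma mpoly_subst_one: "mpoly_subst f 1 = 1"
  using mpoly_subst_mconst[of f 1] by (simp add: mconst_def)

lemma edge_ring_simps:
  "carrier (edge_ring V E) = generate_ring (mpoly_ring V) (range mconst \<union> edge_monomial ` E)"
  "x \<otimes>\<^bsub>edge_ring V E\<^esub> y = x * y" "x \<oplus>\<^bsub>edge_ring V E\<^esub> y = x + y"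
  "\<one>\<^bsub>edge_ring V E\<^esub> = 1" "\<zero>\<^bsub>edge_ring V E\<^esub> = 0"
  by (simp_all add: edge_ring_def mpoly_ring_simps)

lemma toric_map_mvar: "toric_map (mvar \<alpha>) = (\<Prod>x\<in>\<alpha>. mvar x)"
  by (simp add: toric_map_def mpoly_subst_mvar edge_monomial_def)

lemma edge_ring_closed:
  fixes p q :: "('a, 'k::field) mpoly"
  shows "p \<in> carrier (edge_ring V E) \<Longrightarrow> q \<in> carrier (edge_ring V E) \<Longrightarrow>
      p + q \<in> carrier (edge_ring V E)"
    and "p \<in> carrier (edge_ring V E) \<Longrightarrow> q \<in> carrier (edge_ring V E) \<Longrightarrow>
      p * q \<in> carrier (edge_ring V E)"
    and "mconst c \<in> (carrier (edge_ring V E) :: ('a, 'k) mpoly set)"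
  using generate_ring.eng_add[of p "mpoly_ring V" _ q] generate_ring.eng_mult[of p "mpoly_ring V" _ q]
  by (auto simp: edge_ring_simps mpoly_ring_simps intro: generate_ring.incl)

lemma toric_map_closed:
  fixes p :: "('a set, 'k::field) mpoly"
  assumes "p \<in> carrier (mpoly_ring E)"
  shows "toric_map p \<in> carrier (edge_ring V E)"
proof -
  have zero: "0 \<in> (carrier (edge_ring V E) :: ('a, 'k) mpoly set)"
    using edge_ring_closed(3)[of 0] by (simp add: mconst_def)
  have one: "1 \<in> (carrier (edge_ring V E) :: ('a, 'k) mpoly set)"
    using edge_ring_closed(3)[of 1] by (simp add: mconst_def)
  have sum: "sum g A \<in> carrier (edge_ring V E)"
    if "\<And>i. i \<in> A \<Longrightarrow> g i \<in> carrier (edge_ring V E)" for A and g :: "'b \<Rightarrow> ('a, 'k) mpoly"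
    using that by (induction A rule: infinite_finite_induct) (auto simp: zero edge_ring_closed)
  have prod: "prod g A \<in> carrier (edge_ring V E)"
    if "\<And>i. i \<in> A \<Longrightarrow> g i \<in> carrier (edge_ring V E)" for A and g :: "'c \<Rightarrow> ('a, 'k) mpoly"
    using that by (induction A rule: infinite_finite_induct) (auto simp: one edge_ring_closed)
  have pow: "g ^ n \<in> carrier (edge_ring V E)"
    if "g \<in> carrier (edge_ring V E)" for n and g :: "('a, 'k) mpoly"
    using that by (induction n) (auto simp: one edge_ring_closed)
  have "edge_monomial \<alpha> \<in> (carrier (edge_ring V E) :: ('a, 'k) mpoly set)" if "\<alpha> \<in> E" for \<alpha>
    using that by (auto simp: edge_ring_simps intro: generate_ring.incl)
  then show ?thesis
    unfolding toric_map_def mpoly_subst_def using assms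
    by (intro sum edge_ring_closed prod pow) (auto simp: mpoly_ring_simps)
qed

lemma toric_map_hom: "toric_map \<in> ring_hom (mpoly_ring E) (edge_ring V E)"
  by (rule ring_hom_memI)
     (simp add: toric_map_closed,
      simp_all add: toric_map_def mpoly_ring_simps edge_ring_simps mpoly_subst_add mpoly_subst_mult
        mpoly_subst_one)

end

theory Submission
  imports Defs "HOL-Library.Function_Algebras"
begin

text \<open>
  The toric ideal is a prime of height \<open>e - r\<close>, where \<open>r\<close> is the rank of the incidence matrix.

  For the upper bound, let \<open>P \<subset> P'\<close> be primes and \<open>g \<in> P' - P\<close>. Multiplication by \<open>g\<close> embeds
  \<open>S/P\<close> into \<open>P'/P\<close>, so if \<open>S/P'\<close> contains \<open>K\<^sup>s\<close> independent polynomials of degree \<open>O(K)\<close>, then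
  \<open>S/P\<close> contains \<open>K \<cdot> K\<^sup>s\<close> of them. The monomials in the edges of a column basis are independent
  modulo the toric ideal and give growth \<open>K\<^sup>r\<close>, while \<open>S\<close> itself has growth \<open>K\<^sup>e\<close>.

  For the lower bound, enumerate the edges outside a column basis and refine the grading by the
  incidence matrix by the exponents of the first \<open>k\<close> of them; the kernels of these monomial maps
  are primes, strictly decreasing in \<open>k\<close>.

  The rank is \<open>n - p + c\<close>: the differences of pivot equivalent nodes lie in the column space, and
  modulo them all edges of a properly connected component agree.
\<close>

text \<open>The family is indexed, so repetitions must first be excluded: \<open>f i = f j\<close>
  with \<open>i \<noteq> j\<close> would give the relation with coefficients 1 and -1. The image is
  then an independent set in the span of \<open>S\<close>.\<close>

lemma (in vector_space) independent_family_card_le: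
  assumes "finite S" and "finite I" and "\<And>i. i \<in> I \<Longrightarrow> f i \<in> span S"
    and ind: "\<And>c. (\<Sum>i\<in>I. c i *s f i) = 0 \<Longrightarrow> \<forall>i\<in>I. c i = 0"
  shows "card I \<le> card S"
proof -
  have inj: "inj_on f I"
  proof (rule inj_onI, rule ccontr)
    fix i j assume ij: "i \<in> I" "j \<in> I" "f i = f j" "i \<noteq> j"
    define c where "c = (\<lambda>k. if k = i then 1 else if k = j then -1 else 0 :: 'a)"
    have "(\<Sum>k\<in>I. c k *s f k) = (\<Sum>k\<in>{i, j}. c k *s f k)"
      by (rule sum.mono_neutral_right) (use ij assms(2) in \<open>auto simp: c_def\<close>)
    also have "\<dots> = 0" using ij by (simp add: c_def)
    finally have "c i = 0" using ind[of c] ij by blast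
    then show False by (simp add: c_def)
  qed
  have "independent (f ` I)"
  proof (rule independent_if_scalars_zero)
    fix u x assume "(\<Sum>x\<in>f ` I. u x *s x) = 0" "x \<in> f ` I"
    then show "u x = 0" using ind[of "u \<circ> f"] by (auto simp: sum.reindex[OF inj])
  qed (use assms in simp)
  then have "card (f ` I) \<le> card S"
    using independent_span_bound[of S "f ` I"] assms by blast
  then show ?thesis by (simp add: card_image inj)
qed

section \<open>Kernels of monomial maps\<close>

lemma poly_mapping_eqI_on:
  assumes "Poly_Mapping.keys s \<subseteq> A" "Poly_Mapping.keys t \<subseteq> A"
    and "\<And>x. x \<in> A \<Longrightarrow> Poly_Mapping.lookup s x = Poly_Mapping.lookup t x"
  shows "s = t"
proof (rule poly_mapping_eqI)
  fix x show "Poly_Mapping.lookup s x = Poly_Mapping.lookup t x"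
    using assms by (metis in_keys_iff in_mono)
qed

text \<open>The linear map of monoid algebras induced by a map \<open>G\<close> of exponents; for
  additive \<open>G\<close> it is a ring homomorphism. Its kernel consists of the \<open>p\<close>
  whose coefficients sum to zero over every fibre of \<open>G\<close>.\<close>

definition push :: "('m \<Rightarrow> 'c) \<Rightarrow> ('m \<Rightarrow>\<^sub>0 'k) \<Rightarrow> 'c \<Rightarrow>\<^sub>0 'k::comm_monoid_add" where
  "push G p = (\<Sum>t\<in>Poly_Mapping.keys p. Poly_Mapping.single (G t) (Poly_Mapping.lookup p t))"

lemma push_superset:
  assumes "finite A" "Poly_Mapping.keys p \<subseteq> A"
  shows "push G p = (\<Sum>t\<in>A. Poly_Mapping.single (G t) (Poly_Mapping.lookup p t))"
  unfolding push_def
  by (rule sum.mono_neutral_left) (use assms in \<open>auto simp: in_keys_iff\<close>)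

lemma push_zero [simp]: "push G 0 = 0"
  by (simp add: push_def)

lemma push_single [simp]: "push G (Poly_Mapping.single t c) = Poly_Mapping.single (G t) c"
  by (cases "c = 0") (auto simp: push_def)

lemma push_add: "push G (p + q) = push G p + push G q"
proof -
  let ?A = "Poly_Mapping.keys p \<union> Poly_Mapping.keys q"
  have "Poly_Mapping.keys (p + q) \<subseteq> ?A" by (rule Poly_Mapping.keys_add)
  then show ?thesis
    by (simp add: push_superset[of ?A] lookup_add single_add sum.distrib)
qed

lemma push_sum: "push G (sum f A) = (\<Sum>i\<in>A. push G (f i))"
  by (induction A rule: infinite_finite_induct) (auto simp: push_add)

lemma push_uminus: "push G (- p) = - push G (p :: _ \<Rightarrow>\<^sub>0 'k::ab_group_add)"
  using push_add[of G p "- p"] by (simp add: minus_unique)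

lemma push_mult:
  fixes p q :: "'m::monoid_add \<Rightarrow>\<^sub>0 'k::comm_semiring_0"
  assumes "\<And>s t. G (s + t) = (G s + G t :: 'c::monoid_add)"
  shows "push G (p * q) = push G p * push G q"
proof -
  have expand: "p = (\<Sum>t\<in>Poly_Mapping.keys p. Poly_Mapping.single t (Poly_Mapping.lookup p t))"
    for p :: "'m \<Rightarrow>\<^sub>0 'k"
    by (rule poly_mapping_eqI) (auto simp: lookup_sum lookup_single when_def in_keys_iff)
  have "p * q = (\<Sum>s\<in>Poly_Mapping.keys p. \<Sum>t\<in>Poly_Mapping.keys q.
      Poly_Mapping.single (s + t) (Poly_Mapping.lookup p s * Poly_Mapping.lookup q t))"
    by (subst expand[of p], subst expand[of q]) (simp add: sum_product mult_single)
  then show ?thesis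
    by (simp add: push_sum assms) (simp add: push_def sum_product mult_single)
qed

lemma lookup_push:
  "Poly_Mapping.lookup (push G p) y =
     (\<Sum>t\<in>{t \<in> Poly_Mapping.keys p. G t = y}. Poly_Mapping.lookup p t)"
  by (simp add: push_def lookup_sum lookup_single when_def sum.If_cases Int_def)

text \<open>Every fibre of \<open>G'\<close> is a union of fibres of \<open>G\<close>.\<close>

lemma push_eq_0_coarser:
  assumes coarser: "\<And>s t. s \<in> Poly_Mapping.keys p \<Longrightarrow> t \<in> Poly_Mapping.keys p \<Longrightarrow>
      G s = G t \<Longrightarrow> G' s = G' t"
    and "push G p = 0"
  shows "push G' p = 0"
proof (rule poly_mapping_eqI)
  fix y
  define K where "K = {t \<in> Poly_Mapping.keys p. G' t = y}"
  have "(\<Sum>t\<in>K. Poly_Mapping.lookup p t) =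
      (\<Sum>z\<in>G ` K. \<Sum>t\<in>{t \<in> K. G t = z}. Poly_Mapping.lookup p t)"
    by (rule sum.group[symmetric]) (auto simp: K_def)
  also have "\<dots> = (\<Sum>z\<in>G ` K. Poly_Mapping.lookup (push G p) z)"
  proof (rule sum.cong[OF refl])
    fix z assume "z \<in> G ` K"
    then have "{t \<in> K. G t = z} = {t \<in> Poly_Mapping.keys p. G t = z}"
      using coarser by (auto simp: K_def)
    then show "(\<Sum>t\<in>{t \<in> K. G t = z}. Poly_Mapping.lookup p t) = Poly_Mapping.lookup (push G p) z"
      by (simp add: lookup_push)
  qed
  finally show "Poly_Mapping.lookup (push G' p) y = Poly_Mapping.lookup 0 y"
    by (simp add: assms(2) lookup_push[of G'] K_def)
qed

section \<open>Multigradings of monomials and the kernels they define\<close>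

definition pairing :: "('v \<Rightarrow> nat) \<Rightarrow> ('v \<Rightarrow>\<^sub>0 nat) \<Rightarrow> nat" where
  "pairing l t = (\<Sum>x\<in>Poly_Mapping.keys t. Poly_Mapping.lookup t x * l x)"

lemma pairing_superset:
  assumes "finite A" "Poly_Mapping.keys t \<subseteq> A"
  shows "pairing l t = (\<Sum>x\<in>A. Poly_Mapping.lookup t x * l x)"
  unfolding pairing_def
  by (rule sum.mono_neutral_left) (use assms in \<open>auto simp: in_keys_iff\<close>)

lemma pairing_add: "pairing l (s + t) = pairing l s + pairing l t"
proof -
  let ?A = "Poly_Mapping.keys s \<union> Poly_Mapping.keys t"
  have "Poly_Mapping.keys (s + t) \<subseteq> ?A" by (rule Poly_Mapping.keys_add)
  then show ?thesis
    by (simp add: pairing_superset[of ?A] lookup_add sum.distrib distrib_right)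
qed

text \<open>The multidegree of the monomial \<open>t\<close> in the gradings \<open>ls\<close>.
  Indexing the components by \<open>nat\<close> makes the multidegrees linearly ordered, so that the
  polynomials they index have no zero divisors.\<close>

definition row_weight :: "('v \<Rightarrow> nat) list \<Rightarrow> ('v \<Rightarrow>\<^sub>0 nat) \<Rightarrow> nat \<Rightarrow>\<^sub>0 nat" where
  "row_weight ls t = (\<Sum>i<length ls. Poly_Mapping.single i (pairing (ls ! i) t))"

lemma row_weight_add: "row_weight ls (s + t) = row_weight ls s + row_weight ls t"
  by (simp add: row_weight_def pairing_add single_add sum.distrib)

lemma row_weight_eq_iff:
  "row_weight ls s = row_weight ls t \<longleftrightarrow> (\<forall>l\<in>set ls. pairing l s = pairing l t)"
proof -
  have "Poly_Mapping.lookup (row_weight ls t) i =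
      (if i < length ls then pairing (ls ! i) t else 0)" for i t
    by (simp add: row_weight_def lookup_sum lookup_single when_def)
  then show ?thesis
    by (simp add: poly_mapping_eq_iff fun_eq_iff all_set_conv_all_nth)
qed

text \<open>The toric ideal of the matrix with rows \<open>ls\<close>: the kernel of the monomial
  map given by the multidegree.\<close>

definition row_ideal :: "'v set \<Rightarrow> ('v \<Rightarrow> nat) list \<Rightarrow> ('v, 'k::field) mpoly set" where
  "row_ideal X ls = {p \<in> carrier (mpoly_ring X). push (row_weight ls) p = 0}"

text \<open>More rows cut the monomials into finer fibres, and vanishing sums over the finer fibres
  add up to vanishing sums over the coarser ones.\<close>

lemma row_ideal_antimono:
  assumes "set ls \<subseteq> set ls'"
  shows "row_ideal X ls' \<subseteq> row_ideal X ls"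
  unfolding row_ideal_def
  using push_eq_0_coarser[of _ "row_weight ls'" "row_weight ls"] assms
  by (auto simp: row_weight_eq_iff subset_iff)

lemma mpoly_carrier_0: "0 \<in> carrier (mpoly_ring X)"
  and mpoly_carrier_1: "1 \<in> carrier (mpoly_ring X)"
  and mpoly_carrier_uminus: "p \<in> carrier (mpoly_ring X) \<Longrightarrow> - p \<in> carrier (mpoly_ring X)"
  and mpoly_carrier_mconst: "mconst c \<in> carrier (mpoly_ring X)"
  by (auto simp: mpoly_ring_simps in_keys_iff mconst_def lookup_one lookup_single when_def split: if_splits)

lemma mpoly_carrier_sum:
  "(\<And>i. i \<in> A \<Longrightarrow> f i \<in> carrier (mpoly_ring X)) \<Longrightarrow> sum f A \<in> carrier (mpoly_ring X)"
  by (induction A rule: infinite_finite_induct) (auto simp: mpoly_carrier_0 mpoly_carrier_add)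

lemma mpoly_carrier_single:
  "Poly_Mapping.keys t \<subseteq> X \<Longrightarrow> Poly_Mapping.single t c \<in> carrier (mpoly_ring X)"
  by (auto simp: mpoly_ring_simps in_keys_iff lookup_single when_def split: if_splits)

lemma mpoly_ring_uminus:
  assumes "p \<in> carrier (mpoly_ring X)"
  shows "\<ominus>\<^bsub>mpoly_ring X\<^esub> p = - p"
proof -
  interpret cring "mpoly_ring X" by (rule mpoly_ring_cring)
  show ?thesis
    by (rule minus_equality)
       (use assms mpoly_carrier_uminus[of p X] in \<open>auto simp: mpoly_ring_simps(2-5)\<close>)
qed

text \<open>A kernel of a ring homomorphism into a domain: \<open>push\<close> is multiplicative
  because the multidegree is additive, and its target has no zero divisors.\<close>

lemma primeideal_row_ideal: "primeideal (row_ideal X ls :: ('v, 'k::field) mpoly set) (mpoly_ring X)"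
proof (rule primeidealI2)
  interpret cring "mpoly_ring X :: ('v, 'k) mpoly ring" by (rule mpoly_ring_cring)
  note mult = push_mult[of "row_weight ls", OF row_weight_add]
  show "additive_subgroup (row_ideal X ls :: ('v, 'k) mpoly set) (mpoly_ring X)"
    by (intro additive_subgroup.intro add.subgroupI)
       (auto simp: row_ideal_def mpoly_carrier_0 mpoly_carrier_add mpoly_carrier_uminus
          mpoly_ring_uminus push_add push_uminus mpoly_ring_simps(2-5) intro: exI[of _ 0]
          simp flip: a_inv_def)
  show "x \<otimes>\<^bsub>mpoly_ring X\<^esub> a \<in> row_ideal X ls" "a \<otimes>\<^bsub>mpoly_ring X\<^esub> x \<in> row_ideal X ls"
    if "a \<in> row_ideal X ls" "x \<in> carrier (mpoly_ring X)" for a x :: "('v, 'k) mpoly"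
    using that by (auto simp: row_ideal_def mpoly_carrier_mult mult mpoly_ring_simps(2-5))
  have "push (row_weight ls) (1 :: ('v, 'k) mpoly) \<noteq> 0"
    using push_single[of "row_weight ls" 0 "1::'k"]
    by (metis single_one single_zero lookup_single_eq lookup_zero zero_neq_one)
  then show "carrier (mpoly_ring X) \<noteq> (row_ideal X ls :: ('v, 'k) mpoly set)"
    using mpoly_carrier_1[of X] by (auto simp: row_ideal_def)
  show "a \<in> row_ideal X ls \<or> b \<in> row_ideal X ls"
    if "a \<in> carrier (mpoly_ring X)" "b \<in> carrier (mpoly_ring X)"
      "a \<otimes>\<^bsub>mpoly_ring X\<^esub> b \<in> row_ideal X ls" for a b :: "('v, 'k) mpoly"
    using that by (auto simp: row_ideal_def mult mpoly_ring_simps(2-5))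
qed (rule mpoly_ring_cring)

section \<open>The toric map as a monomial map\<close>

lemma prod_single:
  "(\<Prod>i\<in>A. Poly_Mapping.single (w i) (1::'k::comm_semiring_1)) =
     Poly_Mapping.single (\<Sum>i\<in>A. w i :: 'c::comm_monoid_add) 1"
  by (induction A rule: infinite_finite_induct) (auto simp: mult_single)

lemma single_power:
  "Poly_Mapping.single (Poly_Mapping.single x a) (1::'k::comm_semiring_1) ^ n =
     Poly_Mapping.single (Poly_Mapping.single x (a * n :: nat)) 1"
  by (induction n) (auto simp: mult_single single_add[symmetric])

lemma toric_map_eq_push:
  "toric_map p =
     push (\<lambda>t. \<Sum>\<alpha>\<in>Poly_Mapping.keys t. \<Sum>x\<in>\<alpha>. Poly_Mapping.single x (Poly_Mapping.lookup t \<alpha>)) p"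
proof -
  have "edge_monomial \<alpha> ^ n = (Poly_Mapping.single (\<Sum>x\<in>\<alpha>. Poly_Mapping.single x n) 1 :: ('a, 'b) mpoly)"
    for \<alpha> :: "'a set" and n
    unfolding edge_monomial_def mvar_def prod_power_distrib single_power prod_single by simp
  then show ?thesis
    by (simp add: toric_map_def mpoly_subst_def push_def prod_single mconst_def mult_single)
qed

text \<open>The exponent of a node \<open>y\<close> in the image of a monomial is the pairing with
  the incidence row of \<open>y\<close>. Hence the toric map and the multidegree have the same
  fibres on monomials in the edges, and the kernel depends only on these fibres.\<close>

lemma toric_ideal_eq_row_ideal:
  assumes "hypergraph V E" and "set xs = V"
  shows "(toric_ideal V E :: ('a set, 'k::field) mpoly set) =
    row_ideal E (map (\<lambda>x \<alpha>. of_bool (x \<in> \<alpha>)) xs)" (is "_ = row_ideal E ?ls")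
proof -
  define G :: "('a set \<Rightarrow>\<^sub>0 nat) \<Rightarrow> 'a \<Rightarrow>\<^sub>0 nat" where
    "G t = (\<Sum>\<alpha>\<in>Poly_Mapping.keys t. \<Sum>x\<in>\<alpha>. Poly_Mapping.single x (Poly_Mapping.lookup t \<alpha>))" for t
  have fin: "finite \<alpha>" "\<alpha> \<subseteq> V" if "\<alpha> \<in> E" for \<alpha>
    using assms that by (auto simp: hypergraph_def intro: finite_subset)
  have lookup_G: "Poly_Mapping.lookup (G t) y = pairing (\<lambda>\<alpha>. of_bool (y \<in> \<alpha>)) t"
    if "Poly_Mapping.keys t \<subseteq> E" for t y
    unfolding G_def pairing_def lookup_sum
    by (intro sum.cong refl) (use that fin in \<open>auto simp: lookup_single when_def\<close>)
  have pairing0: "pairing (\<lambda>\<alpha>. of_bool (y \<in> \<alpha>)) t = 0" if "Poly_Mapping.keys t \<subseteq> E" "y \<notin> V" for t y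
    using that fin by (fastforce simp: pairing_def)
  have G_eq_iff: "G s = G t \<longleftrightarrow> row_weight ?ls s = row_weight ?ls t"
    if "Poly_Mapping.keys s \<subseteq> E" "Poly_Mapping.keys t \<subseteq> E" for s t
  proof
    assume "G s = G t"
    then show "row_weight ?ls s = row_weight ?ls t"
      using lookup_G that by (auto simp: row_weight_eq_iff) metis
  next
    assume "row_weight ?ls s = row_weight ?ls t"
    then have "Poly_Mapping.lookup (G s) y = Poly_Mapping.lookup (G t) y" for y
      using that assms(2) pairing0[of _ y] by (cases "y \<in> V") (auto simp: row_weight_eq_iff lookup_G)
    then show "G s = G t" by (rule poly_mapping_eqI)
  qed
  have "push G p = 0 \<longleftrightarrow> push (row_weight ?ls) p = 0"
    if "p \<in> carrier (mpoly_ring E)" for p :: "('a set, 'k) mpoly"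
    using that push_eq_0_coarser[of p G "row_weight ?ls"] push_eq_0_coarser[of p "row_weight ?ls" G] G_eq_iff
    by (auto simp: mpoly_ring_simps)
  then show ?thesis
    by (auto simp: toric_ideal_def a_kernel_def' edge_ring_simps row_ideal_def toric_map_eq_push
        G_def[abs_def])
qed

section \<open>Growth modulo a chain of primes\<close>

lemma mconst_simps:
  "mconst 0 = 0" "mconst 1 = 1" "mconst (c + d) = mconst c + mconst d"
  "mconst (c * d) = mconst c * mconst d"
  by (simp_all add: mconst_def single_add mult_single)

lemma mpoly_vector_space: "vector_space (\<lambda>c (p :: ('v, 'k::field) mpoly). mconst c * p)"
  by unfold_locales (simp_all add: mconst_simps algebra_simps)

text \<open>Each exponent is bounded separately rather than the total degree, so the monomials
  allowed form a box and are easy to count. The bounds add under multiplication.\<close>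

definition exponents_le :: "nat \<Rightarrow> ('v, 'k::field) mpoly \<Rightarrow> bool" where
  "exponents_le N p \<longleftrightarrow> (\<forall>t\<in>Poly_Mapping.keys p. \<forall>x. Poly_Mapping.lookup t x \<le> N)"

lemma exponents_le_mono: "exponents_le M p \<Longrightarrow> M \<le> N \<Longrightarrow> exponents_le N p"
  unfolding exponents_le_def by (meson le_trans)

lemma exponents_le_mult:
  assumes "exponents_le M p" "exponents_le N q"
  shows "exponents_le (M + N) (p * q)"
  unfolding exponents_le_def
proof safe
  fix t x assume "t \<in> Poly_Mapping.keys (p * q)"
  then obtain a b where "t = a + b" "a \<in> Poly_Mapping.keys p" "b \<in> Poly_Mapping.keys q"
    using keys_mult[of p q] by blast
  then show "Poly_Mapping.lookup t x \<le> M + N"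
    using assms by (simp add: exponents_le_def lookup_add add_mono)
qed

lemma exponents_le_exists: "\<exists>N. exponents_le N p"
proof
  let ?N = "\<Sum>t\<in>Poly_Mapping.keys p. \<Sum>x\<in>Poly_Mapping.keys t. Poly_Mapping.lookup t x"
  have "Poly_Mapping.lookup t x \<le> ?N" if "t \<in> Poly_Mapping.keys p" for t x
  proof (cases "x \<in> Poly_Mapping.keys t")
    case True
    have "Poly_Mapping.lookup t x \<le> (\<Sum>x\<in>Poly_Mapping.keys t. Poly_Mapping.lookup t x)"
      using True by (intro member_le_sum) auto
    also have "\<dots> \<le> ?N" using that by (intro member_le_sum) auto
    finally show ?thesis .
  qed (simp add: in_keys_iff)
  then show "exponents_le ?N p" by (simp add: exponents_le_def)
qed

text \<open>\<open>indep_mod X P N h\<close>: the polynomials with exponents at most \<open>N\<close> span a space of dimension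
  at least \<open>h\<close> modulo \<open>P\<close>.\<close>

definition indep_mod :: "'v set \<Rightarrow> ('v, 'k::field) mpoly set \<Rightarrow> nat \<Rightarrow> nat \<Rightarrow> bool" where
  "indep_mod X P N h \<longleftrightarrow> (\<exists>f. (\<forall>i<h. f i \<in> carrier (mpoly_ring X) \<and> exponents_le N (f i)) \<and>
     (\<forall>c. (\<Sum>i<h. mconst (c i) * f i) \<in> P \<longrightarrow> (\<forall>i<h. c i = 0)))"

lemma card_bounded_monomials:
  fixes X :: "'v set" and N :: nat
  assumes "finite X"
  defines "M \<equiv> {t :: 'v \<Rightarrow>\<^sub>0 nat. Poly_Mapping.keys t \<subseteq> X \<and> (\<forall>x. Poly_Mapping.lookup t x \<le> N)}"
  shows "finite M" and "card M \<le> (N + 1) ^ card X"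
proof -
  have inj: "inj_on (\<lambda>t. restrict (Poly_Mapping.lookup t) X) M"
  proof (rule inj_onI)
    fix s t assume st: "s \<in> M" "t \<in> M"
      and eq: "restrict (Poly_Mapping.lookup s) X = restrict (Poly_Mapping.lookup t) X"
    show "s = t"
    proof (rule poly_mapping_eqI_on[of _ X])
      show "Poly_Mapping.lookup s x = Poly_Mapping.lookup t x" if "x \<in> X" for x
        using fun_cong[OF eq, of x] that by simp
    qed (use st in \<open>auto simp: M_def\<close>)
  qed
  have sub: "(\<lambda>t. restrict (Poly_Mapping.lookup t) X) ` M \<subseteq> X \<rightarrow>\<^sub>E {..N}"
    by (auto simp: M_def)
  have fin: "finite (X \<rightarrow>\<^sub>E {..N})" using assms(1) by (intro finite_PiE) auto
  show "finite M" using inj_on_finite[OF inj sub fin] .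
  show "card M \<le> (N + 1) ^ card X"
    using card_inj_on_le[OF inj sub fin] assms(1) by (simp add: card_PiE)
qed

text \<open>Since \<open>0 \<in> P\<close>, independence modulo \<open>P\<close> implies plain
  independence, and all members lie in the span of the monomials in a box.\<close>

lemma indep_mod_le:
  assumes "finite X" "0 \<in> P" "indep_mod X (P :: ('v, 'k::field) mpoly set) N h"
  shows "h \<le> (N + 1) ^ card X"
proof -
  interpret vs: vector_space "\<lambda>c (p :: ('v, 'k) mpoly). mconst c * p" by (rule mpoly_vector_space)
  define M where "M = {t :: 'v \<Rightarrow>\<^sub>0 nat. Poly_Mapping.keys t \<subseteq> X \<and> (\<forall>x. Poly_Mapping.lookup t x \<le> N)}"
  define S where "S = (\<lambda>t. Poly_Mapping.single t (1::'k)) ` M"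
  note M = card_bounded_monomials[OF assms(1), of N, folded M_def]
  obtain f where f: "\<And>i. i < h \<Longrightarrow> f i \<in> carrier (mpoly_ring X)" "\<And>i. i < h \<Longrightarrow> exponents_le N (f i)"
    and ind: "\<And>c. (\<Sum>i<h. mconst (c i) * f i) \<in> P \<Longrightarrow> \<forall>i<h. c i = 0"
    using assms(3) unfolding indep_mod_def by blast
  have span: "f i \<in> vs.span S" if "i < h" for i
  proof -
    have "f i = (\<Sum>t\<in>Poly_Mapping.keys (f i).
        mconst (Poly_Mapping.lookup (f i) t) * Poly_Mapping.single t 1)"
      by (subst mpoly_expand) (simp add: mconst_def mult_single)
    also have "\<dots> \<in> vs.span S"
    proof (intro vs.span_sum vs.span_scale vs.span_base)
      fix t assume "t \<in> Poly_Mapping.keys (f i)"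
      then show "Poly_Mapping.single t 1 \<in> S"
        using f[OF that] by (auto simp: S_def M_def mpoly_ring_simps exponents_le_def)
    qed
    finally show ?thesis .
  qed
  have "card {..<h} \<le> card S"
  proof (rule vs.independent_family_card_le)
    show "\<forall>i\<in>{..<h}. c i = 0" if "(\<Sum>i\<in>{..<h}. mconst (c i) * f i) = 0" for c
      using ind[of c] that assms(2) by simp
  qed (use M span in \<open>auto simp: S_def\<close>)
  also have "\<dots> \<le> card M" unfolding S_def using M(1) by (rule card_image_le)
  finally show ?thesis using M(2) by simp
qed

lemma primeideal_mpolyD:
  assumes "primeideal P (mpoly_ring X :: ('v, 'k::field) mpoly ring)"
  shows "P \<subseteq> carrier (mpoly_ring X)" and "0 \<in> P"
    and "p \<in> P \<Longrightarrow> q \<in> P \<Longrightarrow> p + q \<in> P"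
    and "p \<in> P \<Longrightarrow> q \<in> P \<Longrightarrow> p - q \<in> P"
    and "p \<in> P \<Longrightarrow> q \<in> carrier (mpoly_ring X) \<Longrightarrow> p * q \<in> P"
    and "p \<in> carrier (mpoly_ring X) \<Longrightarrow> q \<in> carrier (mpoly_ring X) \<Longrightarrow> p * q \<in> P \<Longrightarrow>
      p \<in> P \<or> q \<in> P"
proof -
  interpret primeideal P "mpoly_ring X" by (rule assms)
  show sub: "P \<subseteq> carrier (mpoly_ring X)" by (rule a_subset)
  show "0 \<in> P" using additive_subgroup.zero_closed[OF additive_subgroup_axioms]
    by (simp add: mpoly_ring_simps(5))
  show add: "p + q \<in> P" if "p \<in> P" "q \<in> P" for p q
    using additive_subgroup.a_closed[OF additive_subgroup_axioms that]
    by (simp add: mpoly_ring_simps(3))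
  have "- q \<in> P" if "q \<in> P" for q
    using additive_subgroup.a_inv_closed[OF additive_subgroup_axioms that] sub that
    by (auto simp: mpoly_ring_uminus)
  then show "p - q \<in> P" if "p \<in> P" "q \<in> P"
    using add[of p "- q"] that by simp
  show "p * q \<in> P" if "p \<in> P" "q \<in> carrier (mpoly_ring X)"
    using I_r_closed[of p q] that by (simp add: mpoly_ring_simps(2-5))
  show "p \<in> P \<or> q \<in> P" if "p \<in> carrier (mpoly_ring X)" "q \<in> carrier (mpoly_ring X)" "p * q \<in> P"
    using I_prime[of p q] that by (simp add: mpoly_ring_simps(2-5))
qed

text \<open>Multiplication by \<open>g\<close> is injective modulo the prime \<open>P\<close> and has image in \<open>P'\<close>.\<close>

lemma indep_mod_add:
  fixes P P' :: "('v, 'k::field) mpoly set"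
  assumes P: "primeideal P (mpoly_ring X)" and P': "primeideal P' (mpoly_ring X)"
    and "P \<subseteq> P'" and g: "g \<in> P'" "g \<notin> P" "exponents_le d g"
    and "indep_mod X P' M h'" and "indep_mod X P N h" and "M \<le> L" "d + N \<le> L"
  shows "indep_mod X P L (h' + h)"
proof -
  obtain f where f: "\<And>i. i < h' \<Longrightarrow> f i \<in> carrier (mpoly_ring X)" "\<And>i. i < h' \<Longrightarrow> exponents_le M (f i)"
    and f_ind: "\<And>c. (\<Sum>i<h'. mconst (c i) * f i) \<in> P' \<Longrightarrow> \<forall>i<h'. c i = 0"
    using assms(7) unfolding indep_mod_def by blast
  obtain e where e: "\<And>i. i < h \<Longrightarrow> e i \<in> carrier (mpoly_ring X)" "\<And>i. i < h \<Longrightarrow> exponents_le N (e i)"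
    and e_ind: "\<And>c. (\<Sum>i<h. mconst (c i) * e i) \<in> P \<Longrightarrow> \<forall>i<h. c i = 0"
    using assms(8) unfolding indep_mod_def by blast
  have g_carrier: "g \<in> carrier (mpoly_ring X)" using primeideal_mpolyD(1)[OF P'] g(1) by blast
  define F where "F i = (if i < h' then f i else g * e (i - h'))" for i
  have "F i \<in> carrier (mpoly_ring X) \<and> exponents_le L (F i)" if "i < h' + h" for i
  proof (cases "i < h'")
    case True
    then show ?thesis using f[OF True] exponents_le_mono[OF _ assms(9)] by (simp add: F_def)
  next
    case False
    then have "i - h' < h" using that by simp
    then show ?thesis
      using False e g_carrier exponents_le_mono[OF exponents_le_mult[OF g(3)] assms(10)]
      by (simp add: F_def mpoly_carrier_mult)
  qed
  moreover have "\<forall>i<h' + h. c i = 0" if *: "(\<Sum>i<h' + h. mconst (c i) * F i) \<in> P" for c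
  proof -
    define p where "p = (\<Sum>i<h'. mconst (c i) * f i)"
    define q where "q = (\<Sum>i<h. mconst (c (h' + i)) * e i)"
    have "(\<Sum>i<h' + h. mconst (c i) * F i) =
        (\<Sum>i<h'. mconst (c i) * F i) + (\<Sum>i<h. mconst (c (i + h')) * F (i + h'))"
      by (induction h) (simp_all add: add_ac)
    also have "\<dots> = p + g * q"
      by (simp add: F_def p_def q_def sum_distrib_left mult_ac add_ac)
    finally have pq: "p + g * q \<in> P" using * by simp
    have q_carrier: "q \<in> carrier (mpoly_ring X)"
      unfolding q_def using e(1)
      by (intro mpoly_carrier_sum mpoly_carrier_mult mpoly_carrier_mconst) auto
    \<comment> \<open>Modulo \<open>P'\<close> only \<open>p\<close> survives, which kills the first
      block of coefficients. What remains is \<open>g * q \<in> P\<close> with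
      \<open>g \<notin> P\<close>, so primality gives \<open>q \<in> P\<close>.\<close>
    have "g * q \<in> P'" by (rule primeideal_mpolyD(5)[OF P' g(1) q_carrier])
    then have "p \<in> P'"
      using primeideal_mpolyD(4)[OF P', of "p + g * q" "g * q"] pq assms(3) by auto
    then have c: "\<forall>i<h'. c i = 0" unfolding p_def by (rule f_ind)
    then have "p = 0" by (simp add: p_def mconst_simps)
    then have "q \<in> P" using primeideal_mpolyD(6)[OF P g_carrier q_carrier] pq g(2) by auto
    then have "\<forall>i<h. c (h' + i) = 0" unfolding q_def by (rule e_ind)
    then show ?thesis using c by (metis add_diff_inverse_nat nat_add_left_cancel_less)
  qed
  ultimately show ?thesis unfolding indep_mod_def by blast
qed

text \<open>Iterating \<open>indep_mod_add\<close> for a fixed \<open>g\<close> in the difference of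
  the primes gains \<open>K ^ s\<close> polynomials per round and costs \<open>d\<close> in the
  exponent bound. After \<open>K\<close> rounds the bound \<open>(a + d) * K\<close> is still linear
  in \<open>K\<close>.\<close>

lemma indep_mod_growth_step:
  fixes P P' :: "('v, 'k::field) mpoly set"
  assumes P: "primeideal P (mpoly_ring X)" and P': "primeideal P' (mpoly_ring X)"
    and sub: "P \<subset> P'" and growth: "\<And>K. indep_mod X P' (a * K) (K ^ s)"
  shows "\<exists>b. \<forall>K. indep_mod X P (b * K) (K ^ Suc s)"
proof -
  obtain g where g: "g \<in> P'" "g \<notin> P" using sub by blast
  obtain d where d: "exponents_le d g" using exponents_le_exists by blast
  have "indep_mod X P (a * K + j * d) (j * K ^ s)" for j K
  proof (induction j)
    case 0
    show ?case by (simp add: indep_mod_def)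
  next
    case (Suc j)
    have "indep_mod X P (a * K + Suc j * d) (K ^ s + j * K ^ s)"
      by (rule indep_mod_add[OF P P' _ g d growth Suc]) (use sub in auto)
    then show ?case by simp
  qed
  from this[where j = K and K = K for K] have "indep_mod X P ((a + d) * K) (K ^ Suc s)" for K
    by (simp add: algebra_simps)
  then show ?thesis by blast
qed

text \<open>Each strict inclusion raises the growth exponent by one, from \<open>r\<close> at the
  top of the chain to \<open>n + r\<close> at the bottom, where it cannot exceed the growth exponent
  \<open>card X\<close> of the whole ring.\<close>

lemma prime_chain_length_le:
  fixes Q :: "nat \<Rightarrow> ('v, 'k::field) mpoly set"
  assumes "finite X" and prime: "\<And>i. i \<le> n \<Longrightarrow> primeideal (Q i) (mpoly_ring X)"
    and strict: "\<And>i. i < n \<Longrightarrow> Q i \<subset> Q (Suc i)"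
    and growth: "\<And>K. indep_mod X (Q n) (a * K) (K ^ r)"
  shows "n + r \<le> card X"
proof (rule ccontr)
  let ?e = "card X"
  assume contra: "\<not> n + r \<le> ?e"
  \<comment> \<open>The induction descends from the largest prime; the slope \<open>b\<close> may
    change at every step but does not depend on \<open>K\<close>.\<close>
  have "\<exists>b. \<forall>K. indep_mod X (Q (n - j)) (b * K) (K ^ (j + r))" if "j \<le> n" for j
    using that
  proof (induction j)
    case 0
    show ?case using growth by auto
  next
    case (Suc j)
    then obtain b where b: "\<And>K. indep_mod X (Q (n - j)) (b * K) (K ^ (j + r))" by auto
    have "Q (n - Suc j) \<subset> Q (n - j)"
      using strict[of "n - Suc j"] Suc.prems by (simp add: Suc_diff_Suc)
    then show ?case
      using indep_mod_growth_step[OF prime prime _ b, of "n - Suc j"] Suc.prems by simp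
  qed
  from this[of n] obtain b where b: "\<And>K. indep_mod X (Q 0) (b * K) (K ^ (n + r))" by auto
  \<comment> \<open>Large enough that \<open>K\<close> exceeds \<open>(b + 1) ^ ?e\<close>, the
    constant factor in front of \<open>K ^ ?e\<close> below.\<close>
  define K where "K = (b + 1) ^ ?e + 1"
  have K: "K \<ge> 1" by (simp add: K_def)
  have "K ^ Suc ?e \<le> K ^ (n + r)" using contra K by (intro power_increasing) auto
  also have "\<dots> \<le> (b * K + 1) ^ ?e"
    using indep_mod_le[OF assms(1) primeideal_mpolyD(2)[OF prime[of 0]] b] by simp
  also have "\<dots> \<le> ((b + 1) * K) ^ ?e" using K by (intro power_mono) auto
  also have "\<dots> = (b + 1) ^ ?e * K ^ ?e" by (rule power_mult_distrib)
  also have "\<dots> < K * K ^ ?e" using K by (intro mult_strict_right_mono) (auto simp: K_def)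
  finally show False by simp
qed

text \<open>The \<open>K ^ card B\<close> monomials in \<open>B\<close> with exponents below
  \<open>K\<close> have pairwise distinct multidegrees, so they stay independent after applying the
  monomial map.\<close>

lemma row_ideal_growth:
  assumes "finite B" "B \<subseteq> X"
    and inj: "\<And>s t. Poly_Mapping.keys s \<subseteq> B \<Longrightarrow> Poly_Mapping.keys t \<subseteq> B \<Longrightarrow>
      \<forall>l\<in>set ls. pairing l s = pairing l t \<Longrightarrow> s = t"
  shows "indep_mod X (row_ideal X ls :: ('v, 'k::field) mpoly set) K (K ^ card B)"
proof -
  let ?I = "B \<rightarrow>\<^sub>E {..<K}"
  have "card ?I = K ^ card B" "finite ?I" using assms(1) by (auto simp: card_PiE intro: finite_PiE)
  then obtain h where h: "bij_betw h {..<K ^ card B} ?I"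
    using ex_bij_betw_nat_finite[of ?I] by (auto simp: atLeast0LessThan)
  define t where "t i = (\<Sum>b\<in>B. Poly_Mapping.single b (h i b))" for i
  have h_mem: "h i \<in> ?I" if "i < K ^ card B" for i using h that by (auto simp: bij_betw_def)
  have lookup_t: "Poly_Mapping.lookup (t i) x = (if x \<in> B then h i x else 0)" for i x
    using assms(1) by (simp add: t_def lookup_sum lookup_single when_def)
  have keys_t: "Poly_Mapping.keys (t i) \<subseteq> B" for i by (auto simp: in_keys_iff lookup_t split: if_splits)
  have inj_t: "i = j"
    if "i < K ^ card B" "j < K ^ card B" "row_weight ls (t i) = row_weight ls (t j)" for i j
  proof -
    have "t i = t j" using inj[OF keys_t keys_t] that(3) by (simp add: row_weight_eq_iff)
    then have "h i x = h j x" if "x \<in> B" for x using that lookup_t[of i x] lookup_t[of j x] by simp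
    then have "h i = h j" by (rule PiE_ext[OF h_mem[OF that(1)] h_mem[OF that(2)]])
    then show ?thesis using h that by (auto simp: bij_betw_def inj_on_def)
  qed
  show ?thesis
    unfolding indep_mod_def
  proof (intro exI[of _ "\<lambda>i. Poly_Mapping.single (t i) (1::'k)"] conjI allI impI)
    fix i assume i: "i < K ^ card B"
    show "Poly_Mapping.single (t i) 1 \<in> carrier (mpoly_ring X)"
      using keys_t assms(2) by (intro mpoly_carrier_single) blast
    show "exponents_le K (Poly_Mapping.single (t i) (1::'k))"
      using h_mem[OF i] by (auto simp: exponents_le_def lookup_t PiE_iff less_imp_le)
  next
    fix c :: "nat \<Rightarrow> 'k" and j
    assume sum: "(\<Sum>i<K ^ card B. mconst (c i) * Poly_Mapping.single (t i) 1) \<in> row_ideal X ls"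
      and j: "j < K ^ card B"
    have "(\<Sum>i<K ^ card B. Poly_Mapping.single (row_weight ls (t i)) (c i)) = 0"
      using sum by (simp add: row_ideal_def push_sum mconst_def mult_single)
    \<comment> \<open>Comparing coefficients at the multidegree of \<open>t j\<close>, where only
      the term \<open>j\<close> contributes.\<close>
    then have "0 = (\<Sum>i<K ^ card B. c i when row_weight ls (t i) = row_weight ls (t j))"
      by (metis (no_types, lifting) lookup_single lookup_sum lookup_zero sum.cong)
    also have "\<dots> = (\<Sum>i<K ^ card B. if i = j then c i else 0)"
      by (intro sum.cong refl) (use inj_t j in \<open>auto simp: when_def\<close>)
    also have "\<dots> = c j" using j by simp
    finally show "c j = 0" by simp
  qed
qed

section \<open>The rank of the incidence matrix\<close>

text \<open>A column of the incidence matrix. The entries are rational whatever the field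
  \<open>'k\<close> is, since the ideal is governed by integer relations between exponent vectors.
  On a singleton this is a standard basis vector.\<close>

definition edge_vector :: "'a set \<Rightarrow> 'a \<Rightarrow> rat" where
  "edge_vector \<alpha> x = of_bool (x \<in> \<alpha>)"

abbreviation scale_fun :: "rat \<Rightarrow> ('a \<Rightarrow> rat) \<Rightarrow> 'a \<Rightarrow> rat" where
  "scale_fun c f \<equiv> (\<lambda>x. c * f x)"

interpretation rat_fun: vector_space scale_fun
  by unfold_locales (simp_all add: fun_eq_iff algebra_simps)

lemma sum_fun_apply: "(\<Sum>i\<in>A. f i) x = (\<Sum>i\<in>A. f i x :: 'b::comm_monoid_add)"
  by (induction A rule: infinite_finite_induct) auto

lemma edge_vector_eq_iff: "edge_vector \<alpha> = edge_vector \<beta> \<longleftrightarrow> \<alpha> = \<beta>"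
  by (auto simp: edge_vector_def fun_eq_iff)

section \<open>Pivots, components and differences of edge vectors\<close>

lemma equiv_pivot_equivalence: "equiv V (pivot_equivalence V E)"
proof (rule equivI)
  have "symp (pivot_adjacent V E)" by (auto simp: symp_def pivot_adjacent_def)
  then have "symp (pivot_adjacent V E)\<^sup>*\<^sup>*" by (rule symp_rtranclp)
  then show "sym (pivot_equivalence V E)"
    by (auto simp: sym_def pivot_equivalence_def dest: sympD)
qed (auto simp: refl_on_def trans_def pivot_equivalence_def)

lemma successively_rev_symmetric:
  assumes "\<And>x y. P x y \<Longrightarrow> P y x" "successively P xs"
  shows "successively P (rev xs)"
  using assms by (auto simp: successively_rev elim!: successively_mono)

text \<open>Edge sequences can be reversed, and two of them can be concatenated because the last
  edge of the first and the first edge of the second share the middle node.\<close>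

lemma equiv_connection: "equiv V (connection V E)"
proof (rule equivI)
  show "sym (connection V E)"
  proof (rule symI)
    fix x y assume xy: "(x, y) \<in> connection V E"
    show "(y, x) \<in> connection V E"
    proof (cases "x = y")
      case False
      obtain \<alpha>s where \<alpha>s: "\<alpha>s \<noteq> []" "set \<alpha>s \<subseteq> E" "x \<in> hd \<alpha>s" "y \<in> last \<alpha>s"
        "successively (\<lambda>\<alpha> \<beta>. \<alpha> \<inter> \<beta> \<noteq> {}) \<alpha>s"
        using xy False by (auto simp: connection_def)
      have "successively (\<lambda>\<alpha> \<beta>. \<alpha> \<inter> \<beta> \<noteq> {}) (rev \<alpha>s)"
        by (rule successively_rev_symmetric[OF _ \<alpha>s(5)]) blast
      then show ?thesis
        using xy \<alpha>s by (auto simp: connection_def hd_rev last_rev intro!: exI[of _ "rev \<alpha>s"])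
    qed (use xy in simp)
  qed
  show "trans (connection V E)"
  proof (rule transI)
    fix x y z assume xy: "(x, y) \<in> connection V E" and yz: "(y, z) \<in> connection V E"
    show "(x, z) \<in> connection V E"
    proof (cases "x = y \<or> y = z")
      case False
      then obtain \<alpha>s \<beta>s where \<alpha>s: "\<alpha>s \<noteq> []" "set \<alpha>s \<subseteq> E" "x \<in> hd \<alpha>s" "y \<in> last \<alpha>s"
          "successively (\<lambda>\<alpha> \<beta>. \<alpha> \<inter> \<beta> \<noteq> {}) \<alpha>s"
        and \<beta>s: "\<beta>s \<noteq> []" "set \<beta>s \<subseteq> E" "y \<in> hd \<beta>s" "z \<in> last \<beta>s"
          "successively (\<lambda>\<alpha> \<beta>. \<alpha> \<inter> \<beta> \<noteq> {}) \<beta>s"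
        using xy yz False by (auto simp: connection_def)
      have "successively (\<lambda>\<alpha> \<beta>. \<alpha> \<inter> \<beta> \<noteq> {}) (\<alpha>s @ \<beta>s)"
        using \<alpha>s \<beta>s by (auto simp: successively_append_iff)
      then show ?thesis
        using xy yz \<alpha>s \<beta>s by (auto simp: connection_def intro!: exI[of _ "\<alpha>s @ \<beta>s"])
    qed (use xy yz in auto)
  qed
qed (auto simp: refl_on_def connection_def)

lemma edge_subset_component:
  assumes "hypergraph V E" "\<alpha> \<in> E" "x \<in> \<alpha>"
  shows "\<alpha> \<subseteq> connection V E `` {x}"
proof
  fix y assume "y \<in> \<alpha>"
  then show "y \<in> connection V E `` {x}"
    using assms by (auto simp: connection_def hypergraph_def intro!: exI[of _ "[\<alpha>]"])
qed

text \<open>The common part \<open>A\<close> cancels, because it avoids both \<open>x\<close> and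
  \<open>y\<close>.\<close>

lemma pivot_adjacent_edge_vector:
  assumes "pivot_adjacent V E x y"
  obtains \<alpha> \<beta> where "\<alpha> \<in> E" "\<beta> \<in> E"
    "edge_vector {x} - edge_vector {y} = edge_vector \<alpha> - edge_vector \<beta>"
proof -
  obtain A where A: "A \<subseteq> V - {x, y}" "{x} \<union> A \<in> E" "{y} \<union> A \<in> E"
    using assms by (auto simp: pivot_adjacent_def)
  then have "edge_vector {x} - edge_vector {y} = edge_vector ({x} \<union> A) - edge_vector ({y} \<union> A)"
    by (auto simp: fun_eq_iff edge_vector_def)
  with A that show ?thesis by blast
qed

text \<open>The differences along a chain of pivots telescope.\<close>

lemma pivot_equivalence_edge_vector:
  assumes "(x, y) \<in> pivot_equivalence V E"
  shows "edge_vector {x} - edge_vector {y} \<in> rat_fun.span (edge_vector ` E)"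
proof -
  have "(pivot_adjacent V E)\<^sup>*\<^sup>* x y" using assms by (simp add: pivot_equivalence_def)
  then show ?thesis
  proof (induction rule: rtranclp_induct)
    case base
    show ?case using rat_fun.span_zero by (simp only: diff_self)
  next
    case (step y z)
    obtain \<alpha> \<beta> where ab: "\<alpha> \<in> E" "\<beta> \<in> E"
      "edge_vector {y} - edge_vector {z} = edge_vector \<alpha> - edge_vector \<beta>"
      by (rule pivot_adjacent_edge_vector[OF step(2)])
    have "edge_vector {y} - edge_vector {z} \<in> rat_fun.span (edge_vector ` E)"
      unfolding ab(3) by (rule rat_fun.span_diff; rule rat_fun.span_base) (use ab in auto)
    then have "(edge_vector {x} - edge_vector {y}) + (edge_vector {y} - edge_vector {z})
        \<in> rat_fun.span (edge_vector ` E)"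
      by (rule rat_fun.span_add[OF step(3)])
    then show ?case by (simp only: diff_add_cancel add_diff_eq)
  qed
qed

text \<open>For \<open>m > 1\<close> the common part \<open>A\<close> of a pivot is nonempty, so the
  two edges meet and form an edge sequence from one node to the other.\<close>

lemma pivot_equivalence_subset_connection:
  assumes "uniform m E" "m > 1"
  shows "pivot_equivalence V E \<subseteq> connection V E"
proof safe
  fix x y assume xy: "(x, y) \<in> pivot_equivalence V E"
  have trans: "trans (connection V E)" using equiv_connection by (auto simp: equiv_def)
  have "(pivot_adjacent V E)\<^sup>*\<^sup>* x y" "x \<in> V" using xy by (auto simp: pivot_equivalence_def)
  then show "(x, y) \<in> connection V E"
  proof (induction rule: rtranclp_induct)
    case base
    then show ?case by (simp add: connection_def)
  next
    case (step y z)
    obtain A where A: "A \<subseteq> V - {y, z}" "{y} \<union> A \<in> E" "{z} \<union> A \<in> E"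
      using step(2) by (auto simp: pivot_adjacent_def)
    have "A \<noteq> {}" using A(2) assms by (auto simp: uniform_def)
    then have "(y, z) \<in> connection V E"
      using step(2) A unfolding connection_def pivot_adjacent_def
      by (auto intro!: exI[of _ "[{y} \<union> A, {z} \<union> A]"])
    then show ?case using step transD[OF trans] by blast
  qed
qed

text \<open>Two sets of size \<open>m\<close> meeting in \<open>m - 1\<close> elements differ by
  exchanging one element, and the intersection serves as the common part of a pivot.\<close>

lemma edge_exchange_pivot:
  assumes "hypergraph V E" "uniform m E" "m > 1" "\<alpha> \<in> E" "\<beta> \<in> E" "card (\<alpha> \<inter> \<beta>) = m - 1"
  obtains x y where "pivot_adjacent V E x y"
    "edge_vector \<alpha> - edge_vector \<beta> = edge_vector {x} - edge_vector {y}"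
proof -
  have fin: "finite \<alpha>" "finite \<beta>" "\<alpha> \<subseteq> V" "\<beta> \<subseteq> V"
    using assms by (auto simp: hypergraph_def intro: finite_subset)
  have card: "card \<alpha> = m" "card \<beta> = m" using assms by (auto simp: uniform_def)
  have "card (\<alpha> - \<beta>) = 1" "card (\<beta> - \<alpha>) = 1"
    using fin card assms(3,6) by (simp_all add: card_Diff_subset_Int Int_commute)
  then obtain x y where xy: "\<alpha> - \<beta> = {x}" "\<beta> - \<alpha> = {y}" by (auto simp: card_1_singleton_iff)
  have "{x} \<union> (\<alpha> \<inter> \<beta>) = \<alpha>" "{y} \<union> (\<alpha> \<inter> \<beta>) = \<beta>" using xy by blast+
  then have "{x} \<union> (\<alpha> \<inter> \<beta>) \<in> E" "{y} \<union> (\<alpha> \<inter> \<beta>) \<in> E" using assms(4,5) by metis+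
  moreover have "x \<in> V" "y \<in> V" "\<alpha> \<inter> \<beta> \<subseteq> V - {x, y}" using xy fin by blast+
  ultimately have "pivot_adjacent V E x y" unfolding pivot_adjacent_def by blast
  moreover have "edge_vector \<alpha> - edge_vector \<beta> = edge_vector {x} - edge_vector {y}"
  proof
    fix z
    have "z \<in> \<alpha> \<and> z \<notin> \<beta> \<longleftrightarrow> z = x" "z \<in> \<beta> \<and> z \<notin> \<alpha> \<longleftrightarrow> z = y" using xy by auto
    then show "(edge_vector \<alpha> - edge_vector \<beta>) z = (edge_vector {x} - edge_vector {y}) z"
      by (cases "z \<in> \<alpha>"; cases "z \<in> \<beta>") (auto simp: edge_vector_def)
  qed
  ultimately show ?thesis using that by blast
qed


lemma successively_hd_last:
  assumes "successively P xs" "xs \<noteq> []" "\<And>x. x \<in> set xs \<Longrightarrow> R x x"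
    and "\<And>x y. x \<in> set xs \<Longrightarrow> y \<in> set xs \<Longrightarrow> P x y \<Longrightarrow> R x y" and "transp R"
  shows "R (hd xs) (last xs)"
  using assms(1-4)
proof (induction xs rule: induct_list012)
  case (3 x y zs)
  have "R y (last (y # zs))" using 3 by simp
  moreover have "R x y" using 3 by simp
  ultimately show ?case using transpD[OF assms(5), of x y "last (y # zs)"] by simp
qed auto

text \<open>An explicit basis of the column space is exhibited: the differences between each node
  and the representative of its pivot class, for the \<open>n - p\<close> nodes that are not
  representatives, and one edge vector for each of the \<open>c\<close> components.\<close>

lemma rank_edge_vectors:
  assumes hyp: "hypergraph V E" and no_iso: "no_isolated_nodes V E" and unif: "uniform m E"
    and "m \<noteq> 1" and proper: "\<forall>C\<in>components V E. properly_connected m (edges_on E C)"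
    and B: "B \<subseteq> edge_vector ` E" "rat_fun.independent B" "edge_vector ` E \<subseteq> rat_fun.span B"
  shows "card B + card (pivot_classes V E) = card V + card (components V E)"
proof (cases "m = 0")
  case True
  \<comment> \<open>For \<open>m = 0\<close> the only possible edge is empty. Then there are no
    nodes, and the only possible edge vector is zero, so every count in the claim is 0.\<close>
  have "\<alpha> = {}" if "\<alpha> \<in> E" for \<alpha>
  proof -
    have "card \<alpha> = 0" "finite \<alpha>"
      using that hyp unif True by (auto simp: hypergraph_def uniform_def intro: finite_subset)
    then show ?thesis by simp
  qed
  then have "V = {}" and "B \<subseteq> {0}"
    using no_iso B(1) by (fastforce simp: no_isolated_nodes_def edge_vector_def fun_eq_iff)+
  moreover have "0 \<notin> B" using B(2) rat_fun.dependent_zero by blast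
  ultimately have "V = {}" "B = {}" by auto
  then show ?thesis by (simp add: pivot_classes_def components_def)
next
  case False
  then have m: "m > 1" using assms(4) by simp
  let ?R = "pivot_equivalence V E" and ?S = "connection V E" and ?\<chi> = "edge_vector :: 'a set \<Rightarrow> _"
  note R = equiv_pivot_equivalence[of V E] and S = equiv_connection[of V E]
  have fin: "finite V" "finite E" "finite (components V E)" "finite (pivot_classes V E)"
    using hyp by (auto simp: hypergraph_def components_def pivot_classes_def quotient_def
        intro: finite_subset)
  \<comment> \<open>The choice is made from the class as a set, so equivalent nodes get the same
    representative.\<close>
  define \<rho> where "\<rho> x = (SOME y. y \<in> ?R `` {x})" for x
  have \<rho>: "(x, \<rho> x) \<in> ?R" if "x \<in> V" for x
    using equiv_class_self[OF R that] unfolding \<rho>_def by (metis Image_singleton_iff someI)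
  have \<rho>_eq: "\<rho> x = \<rho> y" if "(x, y) \<in> ?R" for x y
    unfolding \<rho>_def by (simp add: equiv_class_eq[OF R that])
  have \<rho>_V: "\<rho> x \<in> V" if "x \<in> V" for x using \<rho>[OF that] by (simp add: pivot_equivalence_def)
  have \<rho>_\<rho>: "\<rho> (\<rho> x) = \<rho> x" if "x \<in> V" for x using \<rho>_eq[OF \<rho>[OF that]] by simp
  have "bij_betw (\<lambda>x. ?R `` {x}) (\<rho> ` V) (pivot_classes V E)"
    unfolding bij_betw_def
  proof
    show "inj_on (\<lambda>x. ?R `` {x}) (\<rho> ` V)"
    proof (rule inj_onI)
      fix x y assume xy: "x \<in> \<rho> ` V" "y \<in> \<rho> ` V" "?R `` {x} = ?R `` {y}"
      then have "(x, y) \<in> ?R" using \<rho>_V eq_equiv_class[OF xy(3) R] by auto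
      moreover have "\<rho> x = x" "\<rho> y = y" using xy \<rho>_\<rho> by auto
      ultimately show "x = y" using \<rho>_eq by metis
    qed
    have "?R `` {\<rho> x} = ?R `` {x}" if "x \<in> V" for x using equiv_class_eq[OF R \<rho>[OF that]] by simp
    then show "(\<lambda>x. ?R `` {x}) ` \<rho> ` V = pivot_classes V E"
      by (auto simp: pivot_classes_def quotient_def image_image)
  qed
  then have card_\<rho>: "card (\<rho> ` V) = card (pivot_classes V E)" by (rule bij_betw_same_card)
  define N where "N = V - \<rho> ` V"
  have card_N: "card N + card (pivot_classes V E) = card V"
    unfolding N_def card_\<rho>[symmetric] using \<rho>_V fin(1)
    by (subst card_Diff_subset) (auto intro!: le_add_diff_inverse2 card_mono)
  have "\<exists>\<alpha>\<in>E. \<alpha> \<subseteq> C" if "C \<in> components V E" for C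
  proof -
    obtain x where x: "x \<in> V" "C = ?S `` {x}" using \<open>C \<in> _\<close> by (auto simp: components_def quotient_def)
    obtain \<alpha> where "\<alpha> \<in> E" "x \<in> \<alpha>" using no_iso x(1) by (auto simp: no_isolated_nodes_def)
    then show ?thesis using edge_subset_component[OF hyp, of \<alpha> x] x by blast
  qed
  then obtain \<epsilon> where \<epsilon>: "\<And>C. C \<in> components V E \<Longrightarrow> \<epsilon> C \<in> E" "\<And>C. C \<in> components V E \<Longrightarrow> \<epsilon> C \<subseteq> C"
    by metis
  \<comment> \<open>Index set of the basis: nodes that are not representatives, and components, each
    with a chosen edge \<open>\<epsilon> C\<close>.\<close>
  define I where "I = N <+> components V E"
  define f where "f = case_sum (\<lambda>x. ?\<chi> {x} - ?\<chi> {\<rho> x}) (\<lambda>C. ?\<chi> (\<epsilon> C))"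
  have finI: "finite I" "finite N" using fin by (auto simp: I_def N_def)
  have card_I: "card I = card N + card (components V E)"
    using fin finI by (simp add: I_def card_Plus)
  have finB: "finite B" using B(1) fin by (auto intro: finite_subset)

  have "card I \<le> card B"
  proof (rule rat_fun.independent_family_card_le[OF finB finI(1), where f = f])
    fix i assume "i \<in> I"
    have "f i \<in> rat_fun.span (?\<chi> ` E)"
    proof (cases i)
      case (Inl x)
      then have "x \<in> V" using \<open>i \<in> I\<close> by (auto simp: I_def N_def)
      then show ?thesis using pivot_equivalence_edge_vector[OF \<rho>] Inl by (simp add: f_def)
    next
      case (Inr C)
      then show ?thesis using \<open>i \<in> I\<close> \<epsilon>(1) by (auto simp: f_def I_def intro!: rat_fun.span_base)
    qed
    then show "f i \<in> rat_fun.span B"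
      using rat_fun.span_minimal[OF B(3) rat_fun.subspace_span] by blast
  next
    fix c :: "'a + 'a set \<Rightarrow> rat"
    assume sum0: "(\<Sum>i\<in>I. scale_fun (c i) (f i)) = 0"
    define a where "a x = c (Inl x)" for x
    define b where "b C = c (Inr C)" for C
    have "(\<Sum>i\<in>I. c i * f i z) = 0" for z
      using fun_cong[OF sum0, of z] by (simp add: sum_fun_apply)
    then have eq0: "(\<Sum>x\<in>N. a x * (of_bool (z = x) - of_bool (z = \<rho> x))) +
        (\<Sum>C\<in>components V E. b C * of_bool (z \<in> \<epsilon> C)) = 0" for z
      unfolding I_def
      by (subst (asm) sum.Plus) (use fin finI in \<open>auto simp: f_def edge_vector_def a_def b_def\<close>)
    \<comment> \<open>Sum the relation over the nodes of \<open>D\<close>. Each difference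
      contributes 0, as \<open>x\<close> and \<open>\<rho> x\<close> lie in the same component; the
      chosen edges of other components miss \<open>D\<close>, and its own contributes
      \<open>m\<close>. This leaves \<open>b D * m = 0\<close>.\<close>
    have b0: "b D = 0" if D: "D \<in> components V E" for D
    proof -
      have finD: "finite D" using D fin(1) by (auto simp: components_def quotient_def connection_def)
      have "(\<Sum>z\<in>D. of_bool (z = x) - of_bool (z = \<rho> x)) = (0 :: rat)" if "x \<in> N" for x
      proof -
        have "(x, \<rho> x) \<in> ?S"
          using pivot_equivalence_subset_connection[OF unif m] \<rho>[of x] that by (auto simp: N_def)
        moreover have "(\<rho> x, x) \<in> ?S" using calculation S by (auto simp: equiv_def dest: symD)
        ultimately have "x \<in> D \<longleftrightarrow> \<rho> x \<in> D"
          using in_quotient_imp_closed[OF S, of D] D unfolding components_def by blast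
        then show ?thesis using finD by (simp add: sum_subtractf of_bool_def)
      qed
      then have "(\<Sum>z\<in>D. \<Sum>x\<in>N. a x * (of_bool (z = x) - of_bool (z = \<rho> x))) = 0"
        by (subst sum.swap) (simp flip: sum_distrib_left)
      then have "0 = (\<Sum>z\<in>D. \<Sum>C\<in>components V E. b C * of_bool (z \<in> \<epsilon> C))"
        using eq0 by (metis (no_types, lifting) add_cancel_right_left sum.distrib sum.neutral)
      also have "\<dots> = (\<Sum>C\<in>components V E. b C * of_nat (card (D \<inter> \<epsilon> C)))"
        using finD by (subst sum.swap) (simp add: Int_def flip: sum_distrib_left)
      also have "\<dots> = (\<Sum>C\<in>components V E. if C = D then b C * of_nat m else 0)"
      proof (rule sum.cong[OF refl])
        fix C assume C: "C \<in> components V E"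
        show "b C * of_nat (card (D \<inter> \<epsilon> C)) = (if C = D then b C * of_nat m else 0)"
        proof (cases "C = D")
          case True
          then have "D \<inter> \<epsilon> C = \<epsilon> C" using \<epsilon>(2)[OF C] by blast
          then show ?thesis using True \<epsilon>(1)[OF C] unif by (simp add: uniform_def)
        next
          case False
          then have "D \<inter> C = {}" using quotient_disj[OF S] C D unfolding components_def by blast
          then have "D \<inter> \<epsilon> C = {}" using \<epsilon>(2)[OF C] by blast
          then show ?thesis using False by simp
        qed
      qed
      also have "\<dots> = b D * of_nat m" using D fin by simp
      finally show "b D = 0" using m by simp
    qed
    \<comment> \<open>Once the \<open>b\<close> vanish, the coordinate at \<open>y\<close> isolates
      \<open>a y\<close>: a node that is not a representative occurs in no difference but its
      own.\<close>
    have a0: "a y = 0" if "y \<in> N" for y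
    proof -
      have "y \<noteq> \<rho> x" if "x \<in> N" for x using \<open>y \<in> N\<close> that by (auto simp: N_def)
      then have "(\<Sum>x\<in>N. a x * (of_bool (y = x) - of_bool (y = \<rho> x))) = (\<Sum>x\<in>N. if x = y then a x else 0)"
        by (intro sum.cong) auto
      then show ?thesis using eq0[of y] that finI b0 by simp
    qed
    show "\<forall>i\<in>I. c i = 0" using a0 b0 by (auto simp: I_def a_def b_def)
  qed
  moreover have "card B \<le> card I"
  proof -
    let ?W = "rat_fun.span (f ` I)"
    \<comment> \<open>For a representative the difference is zero; the others belong to the
      family.\<close>
    have nonrep: "?\<chi> {x} - ?\<chi> {\<rho> x} \<in> ?W" if "x \<in> V" for x
    proof (cases "x \<in> N")
      case True
      then have "f (Inl x) \<in> ?W" by (intro rat_fun.span_base) (auto simp: I_def)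
      then show ?thesis by (simp add: f_def)
    next
      case False
      then obtain y where "y \<in> V" "x = \<rho> y" using \<open>x \<in> V\<close> by (auto simp: N_def)
      then have "\<rho> x = x" using \<rho>_\<rho> by simp
      then show ?thesis using rat_fun.span_zero by (simp only: diff_self)
    qed
    \<comment> \<open>Pivot adjacent nodes share their representative, which cancels.\<close>
    have piv: "?\<chi> {x} - ?\<chi> {y} \<in> ?W" if "pivot_adjacent V E x y" for x y
    proof -
      have xy: "(x, y) \<in> ?R" "x \<in> V" "y \<in> V"
        using that by (simp_all add: pivot_equivalence_def pivot_adjacent_def[of V E x y] r_into_rtranclp)
      have "(?\<chi> {x} - ?\<chi> {\<rho> x}) - (?\<chi> {y} - ?\<chi> {\<rho> y}) \<in> ?W"
        by (rule rat_fun.span_diff[OF nonrep nonrep]) (use xy in auto)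
      then show ?thesis using \<rho>_eq[OF xy(1)] by simp
    qed
    \<comment> \<open>Proper connectedness joins \<open>\<alpha>\<close> to the chosen edge of its
      component, and every step of that sequence changes the edge vector by a pivot difference,
      which lies in \<open>?W\<close>.\<close>
    have "?\<chi> \<alpha> \<in> ?W" if \<alpha>: "\<alpha> \<in> E" for \<alpha>
    proof -
      have "\<alpha> \<noteq> {}" using unif \<alpha> m by (auto simp: uniform_def)
      then obtain x where x: "x \<in> \<alpha>" by blast
      define C where "C = ?S `` {x}"
      have C: "C \<in> components V E"
        using x \<alpha> hyp by (auto simp: C_def components_def hypergraph_def intro!: quotientI)
      have mem: "\<alpha> \<in> edges_on E C" "\<epsilon> C \<in> edges_on E C"
        using \<alpha> \<epsilon>[OF C] edge_subset_component[OF hyp \<alpha> x] by (auto simp: edges_on_def C_def)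
      obtain \<alpha>s where \<alpha>s: "\<alpha>s \<noteq> []" "set \<alpha>s \<subseteq> edges_on E C" "hd \<alpha>s = \<alpha>" "last \<alpha>s = \<epsilon> C"
          "successively (\<lambda>\<alpha> \<beta>. card (\<alpha> \<inter> \<beta>) = m - 1) \<alpha>s"
        using proper[rule_format, OF C, unfolded properly_connected_def, rule_format, OF mem] by auto
      have "?\<chi> (hd \<alpha>s) - ?\<chi> (last \<alpha>s) \<in> ?W"
      proof (rule successively_hd_last[OF \<alpha>s(5,1), where R = "\<lambda>\<alpha> \<beta>. ?\<chi> \<alpha> - ?\<chi> \<beta> \<in> ?W"])
        show "?\<chi> \<beta> - ?\<chi> \<beta> \<in> ?W" for \<beta> using rat_fun.span_zero by (simp only: diff_self)
        show "?\<chi> \<beta> - ?\<chi> \<gamma> \<in> ?W"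
          if "\<beta> \<in> set \<alpha>s" "\<gamma> \<in> set \<alpha>s" "card (\<beta> \<inter> \<gamma>) = m - 1" for \<beta> \<gamma>
        proof -
          have edges: "\<beta> \<in> E" "\<gamma> \<in> E" using that \<alpha>s(2) by (auto simp: edges_on_def)
          obtain x y where "pivot_adjacent V E x y" "?\<chi> \<beta> - ?\<chi> \<gamma> = ?\<chi> {x} - ?\<chi> {y}"
            by (rule edge_exchange_pivot[OF hyp unif m edges \<open>card (\<beta> \<inter> \<gamma>) = m - 1\<close>])
          then show ?thesis using piv by (simp only:)
        qed
        show "transp (\<lambda>\<alpha> \<beta>. ?\<chi> \<alpha> - ?\<chi> \<beta> \<in> ?W)"
        proof (rule transpI)
          fix \<alpha> \<beta> \<gamma> assume "?\<chi> \<alpha> - ?\<chi> \<beta> \<in> ?W" "?\<chi> \<beta> - ?\<chi> \<gamma> \<in> ?W"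
          then have "(?\<chi> \<alpha> - ?\<chi> \<beta>) + (?\<chi> \<beta> - ?\<chi> \<gamma>) \<in> ?W" by (rule rat_fun.span_add)
          then show "?\<chi> \<alpha> - ?\<chi> \<gamma> \<in> ?W" by (simp only: diff_add_cancel add_diff_eq)
        qed
      qed
      moreover have "?\<chi> (\<epsilon> C) \<in> ?W"
      proof -
        have "f (Inr C) \<in> ?W" using C by (intro rat_fun.span_base) (auto simp: I_def)
        then show ?thesis by (simp add: f_def)
      qed
      ultimately have "(?\<chi> \<alpha> - ?\<chi> (\<epsilon> C)) + ?\<chi> (\<epsilon> C) \<in> ?W"
        unfolding \<alpha>s(3,4) by (rule rat_fun.span_add)
      then show ?thesis by (simp only: diff_add_cancel)
    qed
    then have "B \<subseteq> ?W" using B(1) by blast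
    then have "card B \<le> card (f ` I)"
      using rat_fun.independent_span_bound[OF _ B(2)] finI by blast
    also have "\<dots> \<le> card I" using finI(1) by (rule card_image_le)
    finally show ?thesis .
  qed
  ultimately show ?thesis using card_I card_N by simp
qed

section \<open>The height of the toric ideal\<close>

text \<open>If the inclusion is strict, a chain ending in \<open>P\<close> is prolonged by
  \<open>P'\<close>. Consequently the infimum defining the height of a prime ideal is attained at
  the ideal itself.\<close>

lemma prime_height_mono:
  assumes "primeideal P' R" "P \<subseteq> P'"
  shows "prime_height R P \<le> prime_height R P'"
proof (cases "P = P'")
  case False
  show ?thesis
    unfolding prime_height_def[of R P]
  proof (rule Sup_least, safe)
    fix n and Q :: "nat \<Rightarrow> _"
    assume Q: "\<forall>i\<le>n. primeideal (Q i) R" "\<forall>i<n. Q i \<subset> Q (Suc i)" "P = Q n"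
    define Q' where "Q' i = (if i \<le> n then Q i else P')" for i
    have "\<forall>i\<le>Suc n. primeideal (Q' i) R" "\<forall>i<Suc n. Q' i \<subset> Q' (Suc i)" "Q' (Suc n) = P'"
      using Q assms False by (auto simp: Q'_def less_Suc_eq)
    then have "enat (Suc n) \<le> prime_height R P'"
      unfolding prime_height_def by (intro Sup_upper) blast
    then show "enat n \<le> prime_height R P'" by (rule order_trans[rotated]) simp
  qed
qed simp

lemma ideal_height_primeideal:
  assumes "primeideal P R"
  shows "ideal_height R P = prime_height R P"
  unfolding ideal_height_def
  by (rule antisym; (rule Inf_lower | rule Inf_greatest))
     (use assms prime_height_mono in auto)

lemma pairing_single [simp]: "pairing l (Poly_Mapping.single x n) = n * l x"
  by (simp add: pairing_def)

lemma pairing_sum: "pairing l (sum f A) = (\<Sum>i\<in>A. pairing l (f i))"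
  by (induction A rule: infinite_finite_induct) (auto simp: pairing_add, simp_all add: pairing_def)

text \<open>The binomial with exponents \<open>s\<close> and \<open>t\<close> separates the ideals:
  its two terms have equal multidegree for \<open>ls\<close> but not for \<open>ls'\<close>.\<close>

lemma row_ideal_strict:
  assumes s: "Poly_Mapping.keys s \<subseteq> X" and t: "Poly_Mapping.keys t \<subseteq> X"
    and eq: "\<And>l. l \<in> set ls \<Longrightarrow> pairing l s = pairing l t"
    and neq: "l \<in> set ls'" "pairing l s \<noteq> pairing l t" and "set ls \<subseteq> set ls'"
  shows "(row_ideal X ls' :: ('v, 'k::field) mpoly set) \<subset> row_ideal X ls"
proof -
  define p :: "('v, 'k) mpoly" where "p = Poly_Mapping.single s 1 + - Poly_Mapping.single t 1"
  have push_p: "push (row_weight ks) p =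
      Poly_Mapping.single (row_weight ks s) 1 - Poly_Mapping.single (row_weight ks t) 1" for ks
    unfolding p_def push_add push_uminus by simp
  have "p \<in> carrier (mpoly_ring X)"
    unfolding p_def using s t by (intro mpoly_carrier_add mpoly_carrier_uminus mpoly_carrier_single)
  moreover have "row_weight ls s = row_weight ls t" using eq by (simp add: row_weight_eq_iff)
  ultimately have "p \<in> row_ideal X ls" by (simp add: row_ideal_def push_p)
  moreover have "row_weight ls' s \<noteq> row_weight ls' t" using neq by (auto simp: row_weight_eq_iff)
  then have "Poly_Mapping.lookup (push (row_weight ls') p) (row_weight ls' s) = 1"
    by (simp add: push_p lookup_minus lookup_single when_def)
  then have "p \<notin> row_ideal X ls'" by (auto simp: row_ideal_def)
  ultimately show ?thesis using row_ideal_antimono[OF assms(6), of X, where 'b = 'k] by blast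
qed

text \<open>Turns a rational relation between edge vectors into an integer one, and so into a
  binomial.\<close>

lemma common_denominator:
  assumes "finite A"
  shows "\<exists>N>0. \<forall>a\<in>A. of_nat N * c a \<in> (\<int> :: rat set)"
  using assms
proof (induction A)
  case (insert a A)
  obtain N where N: "N > 0" "\<forall>a\<in>A. of_nat N * c a \<in> \<int>" using insert.IH by blast
  obtain p q where pq: "quotient_of (c a) = (p, q)" by fastforce
  have q: "q > 0" and ca: "c a = of_int p / of_int q"
    using quotient_of_denom_pos[OF pq] quotient_of_div[OF pq] by auto
  have "of_nat (N * nat q) * c b \<in> \<int>" if "b \<in> insert a A" for b
  proof (cases "b = a")
    case True
    then have "of_nat (N * nat q) * c b = of_int (int N * p)" using q by (simp add: ca)
    then show ?thesis by (metis Ints_of_int)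
  next
    case False
    have "of_nat (N * nat q) * c b = of_int q * (of_nat N * c b)" using q by simp
    then show ?thesis using N(2) that False by (metis Ints_mult Ints_of_int insertE)
  qed
  then show ?case using N(1) q by (intro exI[of _ "N * nat q"]) auto
qed (auto intro: exI[of _ 1])

lemma prime_height_toric_ideal:
  assumes hyp: "hypergraph V E"
    and B: "B \<subseteq> edge_vector ` E" "rat_fun.independent B" "edge_vector ` E \<subseteq> rat_fun.span B"
  shows "prime_height (mpoly_ring E) (toric_ideal V E :: ('a set, 'k::field) mpoly set) =
      enat (card E - card B)"
    and "card B \<le> card E"
    and "primeideal (toric_ideal V E :: ('a set, 'k) mpoly set) (mpoly_ring E)"
proof -
  have fin: "finite V" "finite E" using hyp by (auto simp: hypergraph_def intro: finite_subset)
  \<comment> \<open>The edges of the column basis. Distinct edges have distinct vectors, so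
    \<open>A\<close> and \<open>B\<close> have the same size.\<close>
  define A where "A = {\<alpha> \<in> E. edge_vector \<alpha> \<in> B}"
  have A: "A \<subseteq> E" "finite A" "edge_vector ` A = B" using B(1) fin by (auto simp: A_def)
  have inj: "inj_on edge_vector A" by (simp add: inj_on_def edge_vector_eq_iff)
  have card_A: "card A = card B" using card_image[OF inj] A(3) by simp
  show card_B_le: "card B \<le> card E" using card_mono[OF fin(2) A(1)] card_A by simp
  obtain xs where xs: "set xs = V" using finite_list fin(1) by blast
  obtain es where es: "set es = E - A" "distinct es"
    using finite_distinct_list[of "E - A"] fin(2) by blast
  define n where "n = card E - card B"
  have length_es: "length es = n"
    using distinct_card[OF es(2)] es(1) card_Diff_subset[OF A(2,1)] by (simp add: n_def card_A)
  define rows :: "('a set \<Rightarrow> nat) list" where "rows = map (\<lambda>x \<alpha>. of_bool (x \<in> \<alpha>)) xs"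
  define unit :: "'a set \<Rightarrow> 'a set \<Rightarrow> nat" where "unit f = (\<lambda>\<alpha>. of_bool (\<alpha> = f))" for f
  \<comment> \<open>The incidence rows, refined by rows reading off the exponents of the first
    \<open>k\<close> edges outside \<open>A\<close>.\<close>
  define ls where "ls k = rows @ map unit (take k es)" for k
  have toric: "toric_ideal V E = (row_ideal E rows :: ('a set, 'k) mpoly set)"
    unfolding rows_def by (rule toric_ideal_eq_row_ideal[OF hyp xs])
  show "primeideal (toric_ideal V E :: ('a set, 'k) mpoly set) (mpoly_ring E)"
    unfolding toric by (rule primeideal_row_ideal)
  have edge_vector_outside: "edge_vector \<alpha> x = 0" if "\<alpha> \<in> E" "x \<notin> V" for \<alpha> x
    using that hyp by (auto simp: edge_vector_def hypergraph_def)

  \<comment> \<open>The vector of the next edge is a rational combination of those in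
    \<open>A\<close>. Clearing denominators gives a binomial that only the new row detects.\<close>
  have chain_step: "row_ideal E (ls (Suc j)) \<subset> (row_ideal E (ls j) :: ('a set, 'k) mpoly set)"
    if j: "j < n" for j
  proof -
    let ?f = "es ! j"
    have f: "?f \<in> E" "?f \<notin> A" using es(1) nth_mem[of j es] j length_es by auto
    have finB: "finite B" using A by auto
    have "edge_vector ?f \<in> rat_fun.span B" using B(3) f(1) by blast
    then obtain w where "edge_vector ?f = (\<Sum>v\<in>B. scale_fun (w v) v)"
      using rat_fun.span_finite[OF finB] by auto
    then have w: "edge_vector ?f x = (\<Sum>\<alpha>\<in>A. w (edge_vector \<alpha>) * edge_vector \<alpha> x)" for x
      by (simp add: sum_fun_apply sum.reindex[OF inj] flip: A(3))
    obtain N where N: "N > 0" "\<forall>\<alpha>\<in>A. of_nat N * w (edge_vector \<alpha>) \<in> \<int>"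
      using common_denominator[OF A(2), of "\<lambda>\<alpha>. w (edge_vector \<alpha>)"] by blast
    then obtain z where z: "\<And>\<alpha>. \<alpha> \<in> A \<Longrightarrow> of_nat N * w (edge_vector \<alpha>) = of_int (z \<alpha>)"
      unfolding Ints_def by (auto simp: image_iff) metis
    \<comment> \<open>Exponents must be nonnegative, so the negative coefficients of the relation
      move to the side of \<open>?f\<close>.\<close>
    define s where "s = Poly_Mapping.single ?f N + (\<Sum>\<alpha>\<in>A. Poly_Mapping.single \<alpha> (nat (- z \<alpha>)))"
    define t where "t = (\<Sum>\<alpha>\<in>A. Poly_Mapping.single \<alpha> (nat (z \<alpha>)))"
    have pairing_s: "pairing l s = N * l ?f + (\<Sum>\<alpha>\<in>A. nat (- z \<alpha>) * l \<alpha>)" for l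
      by (simp add: s_def pairing_add pairing_sum)
    have pairing_t: "pairing l t = (\<Sum>\<alpha>\<in>A. nat (z \<alpha>) * l \<alpha>)" for l
      by (simp add: t_def pairing_sum)
    have z_split: "of_nat (nat k) - of_nat (nat (- k)) = (of_int k :: rat)" for k
      by (cases "k \<ge> 0") auto
    have eq_row: "pairing (\<lambda>\<alpha>. of_bool (x \<in> \<alpha>)) s = pairing (\<lambda>\<alpha>. of_bool (x \<in> \<alpha>)) t" for x
    proof -
      have "of_nat N * edge_vector ?f x = (\<Sum>\<alpha>\<in>A. of_int (z \<alpha>) * edge_vector \<alpha> x)"
        unfolding w sum_distrib_left by (intro sum.cong) (simp_all flip: z)
      also have "\<dots> = (\<Sum>\<alpha>\<in>A. of_nat (nat (z \<alpha>)) * edge_vector \<alpha> x - of_nat (nat (- z \<alpha>)) * edge_vector \<alpha> x)"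
        by (intro sum.cong refl) (simp add: z_split flip: left_diff_distrib)
      finally have "of_nat N * edge_vector ?f x + (\<Sum>\<alpha>\<in>A. of_nat (nat (- z \<alpha>)) * edge_vector \<alpha> x)
          = (\<Sum>\<alpha>\<in>A. of_nat (nat (z \<alpha>)) * edge_vector \<alpha> x)"
        by (simp add: sum_subtractf)
      then have "of_nat (pairing (\<lambda>\<alpha>. of_bool (x \<in> \<alpha>)) s) = (of_nat (pairing (\<lambda>\<alpha>. of_bool (x \<in> \<alpha>)) t) :: rat)"
        unfolding pairing_s pairing_t edge_vector_def by simp
      then show ?thesis by (simp only: of_nat_eq_iff)
    qed
    have unit_A: "unit g \<alpha> = 0" if "g \<notin> A" "\<alpha> \<in> A" for g \<alpha> using that by (auto simp: unit_def)
    \<comment> \<open>Earlier unit rows vanish on both monomials, which involve only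
      \<open>?f\<close> and edges of \<open>A\<close>. The row of \<open>?f\<close> takes the values
      \<open>N\<close> and 0.\<close>
    have eq_unit: "pairing (unit g) s = pairing (unit g) t" if "g \<in> set (take j es)" for g
    proof -
      have "g \<notin> A" using es(1) in_set_takeD[OF that] by blast
      moreover have "g \<noteq> ?f"
        using that es(2) j length_es by (auto simp: in_set_conv_nth nth_eq_iff_index_eq)
      ultimately show ?thesis by (simp add: pairing_s pairing_t unit_A) (simp add: unit_def)
    qed
    have neq: "pairing (unit ?f) s \<noteq> pairing (unit ?f) t"
      using N(1) f(2) by (simp add: pairing_s pairing_t unit_A) (simp add: unit_def)
    have take_Suc: "take (Suc j) es = take j es @ [?f]"
      using j length_es by (simp add: take_Suc_conv_app_nth)
    have keys: "Poly_Mapping.keys s \<subseteq> E" "Poly_Mapping.keys t \<subseteq> E"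
      using f(1) A(1,2) by (auto simp: s_def t_def in_keys_iff lookup_add lookup_sum lookup_single when_def
        split: if_splits)
    show ?thesis
      by (rule row_ideal_strict[OF keys _ _ neq])
         (auto simp: ls_def rows_def take_Suc eq_row eq_unit)
  qed

  \<comment> \<open>The difference of two exponent vectors with equal multidegree is a linear
    relation between the independent vectors of \<open>A\<close>.\<close>
  have inj_A: "s = t"
    if keys: "Poly_Mapping.keys s \<subseteq> A" "Poly_Mapping.keys t \<subseteq> A"
      and eq: "\<forall>l\<in>set rows. pairing l s = pairing l t" for s t
  proof -
    define u :: "'a set \<Rightarrow> rat" where
      "u \<alpha> = of_nat (Poly_Mapping.lookup s \<alpha>) - of_nat (Poly_Mapping.lookup t \<alpha>)" for \<alpha>
    have "(\<Sum>\<alpha>\<in>A. u \<alpha> * edge_vector \<alpha> x) = 0" for x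
    proof (cases "x \<in> V")
      case True
      have pairing_A: "of_nat (pairing (\<lambda>\<alpha>. of_bool (x \<in> \<alpha>)) r) =
          (\<Sum>\<alpha>\<in>A. of_nat (Poly_Mapping.lookup r \<alpha>) * edge_vector \<alpha> x)"
        if "Poly_Mapping.keys r \<subseteq> A" for r
        by (simp add: pairing_superset[OF A(2) that] edge_vector_def)
      show ?thesis
        using eq True xs pairing_A[OF keys(1)] pairing_A[OF keys(2)]
        by (simp add: u_def left_diff_distrib sum_subtractf rows_def)
    next
      case False
      then show ?thesis using edge_vector_outside A(1) by (intro sum.neutral) auto
    qed
    then have "(\<Sum>\<alpha>\<in>A. scale_fun (u \<alpha>) (edge_vector \<alpha>)) = 0" by (simp add: fun_eq_iff sum_fun_apply)
    \<comment> \<open>The relation is rewritten as one indexed by \<open>B\<close>, where the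
      independence is stated.\<close>
    moreover have "(\<Sum>v\<in>B. scale_fun (u (the_inv_into A edge_vector v)) v) =
        (\<Sum>\<alpha>\<in>A. scale_fun (u \<alpha>) (edge_vector \<alpha>))"
      unfolding A(3)[symmetric] sum.reindex[OF inj]
      by (intro sum.cong refl) (simp add: the_inv_into_f_f[OF inj])
    ultimately have sum0: "(\<Sum>v\<in>B. scale_fun (u (the_inv_into A edge_vector v)) v) = 0" by simp
    have "u \<alpha> = 0" if "\<alpha> \<in> A" for \<alpha>
      using rat_fun.independentD[OF B(2) _ subset_refl sum0, of "edge_vector \<alpha>"] A(2,3) that
        the_inv_into_f_f[OF inj that] by auto
    then show "s = t" by (intro poly_mapping_eqI_on[OF keys]) (simp add: u_def)
  qed

  show "prime_height (mpoly_ring E) (toric_ideal V E :: ('a set, 'k) mpoly set) = enat (card E - card B)"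
    unfolding n_def[symmetric] prime_height_def
  proof (rule antisym[OF Sup_least Sup_upper], safe)
    fix k and Q :: "nat \<Rightarrow> ('a set, 'k) mpoly set"
    assume Q: "\<forall>i\<le>k. primeideal (Q i) (mpoly_ring E)" "\<forall>i<k. Q i \<subset> Q (Suc i)" "Q k = toric_ideal V E"
    have growth: "indep_mod E (Q k) (1 * K) (K ^ card A)" for K
      unfolding Q(3) toric mult_1 by (rule row_ideal_growth[OF A(2,1) inj_A])
    have "k + card A \<le> card E"
      by (rule prime_chain_length_le[of E k Q 1]) (use fin(2) Q growth in auto)
    then show "enat k \<le> enat n" by (simp add: n_def card_A)
  next
    \<comment> \<open>The ideals shrink as \<open>k\<close> grows, so the index is reversed; the
      ascending chain ends at \<open>ls 0\<close>, the incidence rows alone.\<close>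
    have "row_ideal E (ls (n - i)) \<subset> (row_ideal E (ls (n - Suc i)) :: ('a set, 'k) mpoly set)" if "i < n" for i
      using chain_step[of "n - Suc i"] that by (simp add: Suc_diff_Suc)
    then show "\<exists>n'. enat n = enat n' \<and> (\<exists>Q. (\<forall>i\<le>n'. primeideal (Q i) (mpoly_ring E)) \<and>
        (\<forall>i<n'. Q i \<subset> Q (Suc i)) \<and> Q n' = (toric_ideal V E :: ('a set, 'k) mpoly set))"
      by (intro exI[of _ n] conjI exI[of _ "\<lambda>i. row_ideal E (ls (n - i))"])
         (auto simp: toric ls_def intro: primeideal_row_ideal)
  qed
qed

text \<open>Extended reals keep the subtractions from being truncated and admit an infinite height a
  priori. For \<open>m = 1\<close> the formula fails with two or more nodes: then
  \<open>e = c = n\<close>, \<open>p = 1\<close> and the ideal is zero.\<close>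

theorem proposition8p1:
  fixes V :: "'a set" and E :: "'a set set" and m :: nat
  assumes "hypergraph V E"
    and "no_isolated_nodes V E"
    and "\<forall>C\<in>components V E. card (edges_on E C) \<ge> card C"
    and "uniform m E"
    and "m \<noteq> 1"
    and "\<forall>C\<in>components V E. properly_connected m (edges_on E C)"
  shows "ereal_of_enat (ideal_height (mpoly_ring E) (toric_ideal V E :: ('a set, 'k::field) mpoly set)) =
    ereal (real (card E) - real (card V) + real (card (pivot_classes V E)) - real (card (components V E)))"
proof -
  obtain B where B: "B \<subseteq> edge_vector ` E" "rat_fun.independent B" "edge_vector ` E \<subseteq> rat_fun.span B"
    by (rule rat_fun.maximal_independent_subset)
  note height = prime_height_toric_ideal[OF assms(1) B]
  have "card B + card (pivot_classes V E) = card V + card (components V E)"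
    by (rule rank_edge_vectors[OF assms(1,2,4-6) B])
  \<comment> \<open>The bound \<open>card B \<le> card E\<close> makes the truncated difference
    \<open>e - card B\<close> agree with the real one.\<close>
  then show ?thesis
    using height(2) by (simp add: ideal_height_primeideal[OF height(3)] height(1))
qed

end
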